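(* Let $q\ge2$, $n\ge 2$, and let $C$ be a tight $4$-design in $H(n,q)$, with degree set $\{\alpha_1,\alpha_2\}$, $\alpha_1<\alpha_2$. For $1\le i\le q$ let $C_i=\{(x_2,\ldots,x_n):(i,x_2,\ldots,x_n)\in C\}$ and $\tilde C=\bigcup_{i=1}^q C_i\subseteq V^{n-1}$. Define $\tilde S_0=\{(x,y)\in\tilde C\times\tilde C: d(x,y)=0\}$ and, for $i\in\{1,2\}$, $\tilde S_{2i-1}=\{(x,y)\in\tilde C\times\tilde C: d(x,y)=\alpha_i-1\}$, $\tilde S_{2i}=\{(x,y)\in\tilde C\times\tilde C: d(x,y)=\alpha_i\}$. Then $(\tilde C,\{\tilde S_i\}_{i=0}^4)$ is a $Q$-antipodal $Q$-polynomial association scheme of $4$ classes with Krein array $\{(n-1)(q-1),(n-2)(q-1),2(q-1),1;\ 1,2,(n-2)(q-1),(n-1)(q-1)\}$.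
   Context: $V=\{1,\ldots,q\}$, $d$ is the Hamming distance. $H(n,q)$ is the Hamming association scheme on $V^n$. A subset $C\subseteq V^n$ is a $4$-design in $H(n,q)$ iff it is an orthogonal array of strength $4$ (for every $4$ coordinates, each vector of $V^4$ occurs equally often among the restrictions of elements of $C$); it is tight if $|C|=1+n(q-1)+\binom n2(q-1)^2$. The degree set of $C$ is the set of distances $d(x,y)$, $x\ne y\in C$. An association scheme $(X,\{R_i\}_{i=0}^D)$: adjacency matrices $A_i$ with $A_0=I$, $\sum A_i=J$, $A_i^\top=A_i$, $A_iA_j=\sum_k p_{ij}^kA_k$ with nonnegative integers $p_{ij}^k$; primitive idempotents $E_0=\frac1{|X|}J,E_1,\dots,E_D$ of the algebra spanned by the $A_i$. Krein parameters $q_{ij}^k$ are defined by $E_i\circ E_j=\frac1{|X|}\sum_k q_{ij}^kE_k$ ($\circ$ entrywise product). The scheme is $Q$-polynomial (w.r.t. an ordering $E_0,\dots,E_D$) iff the matrix $(q_{1j}^k)_{k,j}$ is tridiagonal with nonzero sub- and superdiagonal entries; then with $b_i^*=q_{1,i+1}^i$, $c_i^*=q_{1,i-1}^i$ its Krein array is $\{b_0^*,\ldots,b_{D-1}^*;c_1^*,\ldots,c_D^*\}$. A $Q$-polynomial scheme is $Q$-antipodal if $b_i^*=c_{D-i}^*$ for all $i$ except possibly $i=\lfloor D/2\rfloor$.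
   Formalization: A 4-design in H(n,q) is taken to require n ≥ 4, although the statement says n ≥ 2; for n = 2 the condition would be vacuous and C = V² a counterexample (S̃_0 = S̃_1), and for n = 3 no such C exists. *)

theory Defs
  imports Complex_Main
begin

section \<open>Words, Hamming distance, designs in the Hamming scheme\<close>

text \<open>
  The set \<open>V\<^sup>n\<close> with \<open>V = {1, \<dots>, q}\<close> is the set of lists of length \<open>n\<close> with entries in \<open>V\<close>.
  The coordinates \<open>1, \<dots>, n\<close> of the mathematics are the list positions \<open>0, \<dots>, n - 1\<close>.
\<close>

definition words :: "nat \<Rightarrow> nat \<Rightarrow> nat list set" where
  "words n q = {x. length x = n \<and> set x \<subseteq> {1..q}}"

text \<open>Only meaningful for two lists of the same length.\<close>

definition hamming_dist :: "'a list \<Rightarrow> 'a list \<Rightarrow> nat" where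
  "hamming_dist x y = card {k. k < length x \<and> x ! k \<noteq> y ! k}"

definition degree_set :: "'a list set \<Rightarrow> nat set" where
  "degree_set C = {hamming_dist x y |x y. x \<in> C \<and> y \<in> C \<and> x \<noteq> y}"

text \<open>
  The term \<open>nths x T\<close> is the restriction of \<open>x\<close> to the coordinates in \<open>T\<close>. As usual for
  orthogonal arrays (and for designs in a \<open>Q\<close>-polynomial scheme with \<open>n\<close> classes), strength \<open>t\<close>
  presupposes \<open>t \<le> n\<close>; without it the condition would be vacuous for \<open>n < t\<close>.
\<close>

definition hamming_design :: "nat \<Rightarrow> nat \<Rightarrow> nat \<Rightarrow> nat list set \<Rightarrow> bool" where
  "hamming_design t n q C \<longleftrightarrow>
     t \<le> n \<and> C \<subseteq> words n q \<and>
     (\<forall>T. T \<subseteq> {..<n} \<and> card T = t \<longrightarrow>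
        (\<exists>m. \<forall>v \<in> words t q. card {x \<in> C. nths x T = v} = m))"

definition tight_4_design :: "nat \<Rightarrow> nat \<Rightarrow> nat list set \<Rightarrow> bool" where
  "tight_4_design n q C \<longleftrightarrow>
     hamming_design 4 n q C \<and>
     card C = 1 + n * (q - 1) + (n choose 2) * (q - 1)\<^sup>2"

definition derived_code :: "nat list set \<Rightarrow> nat \<Rightarrow> nat list set" where
  "derived_code C i = {x. i # x \<in> C}"

definition tilde_code :: "nat \<Rightarrow> nat list set \<Rightarrow> nat list set" where
  "tilde_code q C = (\<Union>i \<in> {1..q}. derived_code C i)"

text \<open>Only the indices \<open>k \<le> 4\<close> are meaningful.\<close>

definition tilde_rel ::
  "nat \<Rightarrow> nat list set \<Rightarrow> nat \<Rightarrow> nat \<Rightarrow> nat \<Rightarrow> (nat list \<times> nat list) set" where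
  "tilde_rel q C \<alpha>1 \<alpha>2 k =
     {(x, y) \<in> tilde_code q C \<times> tilde_code q C.
        hamming_dist x y = [0, \<alpha>1 - 1, \<alpha>1, \<alpha>2 - 1, \<alpha>2] ! k}"


section \<open>Symmetric association schemes\<close>

text \<open>
  Real matrices with rows and columns indexed by a finite set \<open>X\<close> are functions of two arguments
  that vanish outside \<open>X \<times> X\<close>, so that equality of matrices is equality of functions.
\<close>

type_synonym 'a mtx = "'a \<Rightarrow> 'a \<Rightarrow> real"

definition mtx_mult :: "'a set \<Rightarrow> 'a mtx \<Rightarrow> 'a mtx \<Rightarrow> 'a mtx" where
  "mtx_mult X A B = (\<lambda>x y. \<Sum>z\<in>X. A x z * B z y)"

definition mtx_zero :: "'a mtx" where
  "mtx_zero = (\<lambda>x y. 0)"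

definition mtx_one :: "'a set \<Rightarrow> 'a mtx" where
  "mtx_one X = (\<lambda>x y. of_bool (x \<in> X \<and> y = x))"

definition mtx_all_ones :: "'a set \<Rightarrow> 'a mtx" where
  "mtx_all_ones X = (\<lambda>x y. of_bool (x \<in> X \<and> y \<in> X))"

definition adjacency :: "('a \<times> 'a) set \<Rightarrow> 'a mtx" where
  "adjacency R = (\<lambda>x y. of_bool ((x, y) \<in> R))"

definition association_scheme :: "'a set \<Rightarrow> nat \<Rightarrow> (nat \<Rightarrow> ('a \<times> 'a) set) \<Rightarrow> bool" where
  "association_scheme X D R \<longleftrightarrow>
     finite X \<and> X \<noteq> {} \<and>
     (\<forall>i\<le>D. R i \<noteq> {} \<and> R i \<subseteq> X \<times> X) \<and>
     adjacency (R 0) = mtx_one X \<and>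
     (\<lambda>x y. \<Sum>i\<le>D. adjacency (R i) x y) = mtx_all_ones X \<and>
     (\<forall>i\<le>D. (\<lambda>x y. adjacency (R i) y x) = adjacency (R i)) \<and>
     (\<exists>p :: nat \<Rightarrow> nat \<Rightarrow> nat \<Rightarrow> nat. \<forall>i\<le>D. \<forall>j\<le>D.
        mtx_mult X (adjacency (R i)) (adjacency (R j)) =
          (\<lambda>x y. \<Sum>k\<le>D. real (p i j k) * adjacency (R k) x y))"

definition adjacency_algebra :: "nat \<Rightarrow> (nat \<Rightarrow> ('a \<times> 'a) set) \<Rightarrow> 'a mtx set" where
  "adjacency_algebra D R = {\<lambda>x y. \<Sum>i\<le>D. c i * adjacency (R i) x y |c. True}"

definition idempotents :: "'a set \<Rightarrow> 'a mtx set \<Rightarrow> 'a mtx set" where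
  "idempotents X \<A> = {E \<in> \<A>. mtx_mult X E E = E}"

definition primitive_idempotents :: "'a set \<Rightarrow> 'a mtx set \<Rightarrow> 'a mtx set" where
  "primitive_idempotents X \<A> =
     {E \<in> idempotents X \<A>. E \<noteq> mtx_zero \<and>
        \<not> (\<exists>F \<in> idempotents X \<A>. \<exists>G \<in> idempotents X \<A>.
              F \<noteq> mtx_zero \<and> G \<noteq> mtx_zero \<and>
              mtx_mult X F G = mtx_zero \<and> mtx_mult X G F = mtx_zero \<and>
              E = (\<lambda>x y. F x y + G x y))}"

definition idempotent_ordering ::
  "'a set \<Rightarrow> nat \<Rightarrow> (nat \<Rightarrow> ('a \<times> 'a) set) \<Rightarrow> (nat \<Rightarrow> 'a mtx) \<Rightarrow> bool" where
  "idempotent_ordering X D R E \<longleftrightarrow>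
     bij_betw E {..D} (primitive_idempotents X (adjacency_algebra D R)) \<and>
     E 0 = (\<lambda>x y. mtx_all_ones X x y / real (card X))"

text \<open>
  The term \<open>krein X D E i j k\<close> is the Krein parameter \<open>q\<^sub>i\<^sub>j\<^sup>k\<close>. The coefficients with index up to
  \<open>D\<close> are determined because the primitive idempotents are linearly independent; those beyond \<open>D\<close>
  are set to \<open>0\<close> to make the coefficient function unique.
\<close>

definition krein :: "'a set \<Rightarrow> nat \<Rightarrow> (nat \<Rightarrow> 'a mtx) \<Rightarrow> nat \<Rightarrow> nat \<Rightarrow> nat \<Rightarrow> real" where
  "krein X D E i j =
     (THE c. (\<forall>k>D. c k = 0) \<and>
        (\<lambda>x y. E i x y * E j x y) =
          (\<lambda>x y. 1 / real (card X) * (\<Sum>k\<le>D. c k * E k x y)))"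

definition Q_polynomial ::
  "'a set \<Rightarrow> nat \<Rightarrow> (nat \<Rightarrow> ('a \<times> 'a) set) \<Rightarrow> (nat \<Rightarrow> 'a mtx) \<Rightarrow> bool" where
  "Q_polynomial X D R E \<longleftrightarrow>
     association_scheme X D R \<and> 1 \<le> D \<and> idempotent_ordering X D R E \<and>
     (\<forall>j\<le>D. \<forall>k\<le>D.
        (k + 1 < j \<or> j + 1 < k \<longrightarrow> krein X D E 1 j k = 0) \<and>
        (j = k + 1 \<or> k = j + 1 \<longrightarrow> krein X D E 1 j k \<noteq> 0))"

definition krein_b :: "'a set \<Rightarrow> nat \<Rightarrow> (nat \<Rightarrow> 'a mtx) \<Rightarrow> nat \<Rightarrow> real" where
  "krein_b X D E i = krein X D E 1 (i + 1) i"

definition krein_c :: "'a set \<Rightarrow> nat \<Rightarrow> (nat \<Rightarrow> 'a mtx) \<Rightarrow> nat \<Rightarrow> real" where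
  "krein_c X D E i = krein X D E 1 (i - 1) i"

definition krein_array :: "'a set \<Rightarrow> nat \<Rightarrow> (nat \<Rightarrow> 'a mtx) \<Rightarrow> real list \<times> real list" where
  "krein_array X D E = (map (krein_b X D E) [0..<D], map (krein_c X D E) [1..<D + 1])"

definition Q_antipodal ::
  "'a set \<Rightarrow> nat \<Rightarrow> (nat \<Rightarrow> ('a \<times> 'a) set) \<Rightarrow> (nat \<Rightarrow> 'a mtx) \<Rightarrow> bool" where
  "Q_antipodal X D R E \<longleftrightarrow>
     Q_polynomial X D R E \<and>
     (\<forall>i<D. i \<noteq> D div 2 \<longrightarrow> krein_b X D E i = krein_c X D E (D - i))"

end

theory Submission
  imports Defs "HOL-Library.Function_Algebras" "HOL-Library.Ramsey"
begin

text \<open>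
  For a set \<open>T\<close> of coordinates let \<open>\<chi>\<^sub>T(x, y)\<close> be the product of \<open>q [x\<^sub>k = y\<^sub>k] - 1\<close> over \<open>k \<in> T\<close>.
  Strength \<open>4\<close> makes the matrices \<open>\<chi>\<^sub>T / |C|\<close> with \<open>|T| \<le> 2\<close> pairwise orthogonal idempotents on
  \<open>C\<close>, and tightness makes their traces add up to \<open>|C|\<close>, so that they sum to the identity. Off the
  diagonal this is a quadratic equation for the distances of \<open>C\<close>; it gives \<open>\<alpha>\<^sub>1 \<ge> 2\<close> and
  \<open>\<alpha>\<^sub>2 \<ge> \<alpha>\<^sub>1 + 2\<close>, hence deleting the first coordinate is injective on \<open>C\<close>, the five relations are
  disjoint, and the distance of two punctured words determines whether their deleted letters agree.
  Grouping the \<open>\<chi>\<^sub>T\<close> by \<open>|T|\<close> and by whether \<open>T\<close> contains the deleted coordinate yields five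
  idempotents that are constant on the five relations; by dimension they span the same space as the
  adjacency matrices. With \<open>e\<close> the sum of the \<open>\<chi>\<^sub>T\<close> over the singletons \<open>T\<close> of remaining coordinates
  and \<open>\<psi>\<close> the \<open>\<chi>\<close> of the deleted one, the Krein parameters are read off from the products of \<open>e\<close>
  with \<open>1\<close>, \<open>e\<close>, \<open>e\<^sub>2 = (e\<^sup>2 - (q - 2) e - (n - 1) (q - 1)) / 2\<close>, \<open>\<psi> e\<close> and \<open>\<psi>\<close>.
\<close>

section \<open>Spans of matrices\<close>

lemma (in vector_space) span_eq_if_card_le_independent:
  assumes "finite S" and "independent B" and "B \<subseteq> span S" and "card S \<le> card B"
  shows "span B = span S"
proof -
  have "S \<subseteq> span B"
  proof (rule ccontr)
    assume "\<not> S \<subseteq> span B"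
    then obtain v where v: "v \<in> S" "v \<notin> span B"
      by blast
    then have "independent (insert v B)"
      using assms(2) by (simp add: independent_insertI)
    then have "finite (insert v B) \<and> card (insert v B) \<le> card S"
      using assms(1,3) v(1) span_superset by (intro independent_span_bound) auto
    moreover have "v \<notin> B"
      using v(2) span_base by blast
    ultimately show False
      using assms(4) by auto
  qed
  then show ?thesis
    using assms(3) by (simp add: span_minimal subset_antisym)
qed

lemma (in vector_space) independent_if_card_le_independent:
  assumes "finite S" and "independent B" and "B \<subseteq> span S" and "card S \<le> card B"
  shows "independent S"
proof
  assume "dependent S"
  then obtain v where v: "v \<in> S" "v \<in> span (S - {v})"
    by (auto simp: dependent_def)
  then have "span (S - {v}) = span S"
    using span_redundant[OF v(2)] by (simp add: insert_absorb)
  then have "card B \<le> card (S - {v})"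
    using independent_span_bound[OF _ assms(2)] assms(1,3) by auto
  then show False
    using assms(4) card_Diff1_less[OF assms(1) v(1)] by linarith
qed

definition mtx_scale :: "real \<Rightarrow> 'a mtx \<Rightarrow> 'a mtx" where
  "mtx_scale r A = (\<lambda>x y. r * A x y)"

global_interpretation mtx: vector_space mtx_scale
  by unfold_locales (auto simp: mtx_scale_def fun_eq_iff algebra_simps)

lemma sum_mtx_apply: "(\<Sum>i\<in>I. A i :: 'a mtx) x y = (\<Sum>i\<in>I. A i x y)"
  by (induction I rule: infinite_finite_induct) auto

lemma subspace_mtx_combinations:
  fixes A :: "'i \<Rightarrow> 'a mtx"
  shows "mtx.subspace (range (\<lambda>c x y. \<Sum>i\<in>I. c i * A i x y))" (is "mtx.subspace (range ?L)")
proof (rule mtx.subspaceI)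
  show "0 \<in> range ?L"
    by (intro range_eqI[of _ _ "\<lambda>_. 0"]) (simp add: fun_eq_iff)
  show "M + N \<in> range ?L" if "M \<in> range ?L" "N \<in> range ?L" for M N
  proof -
    from that obtain c d where "M = ?L c" "N = ?L d"
      by blast
    then show ?thesis
      by (intro range_eqI[of _ _ "\<lambda>i. c i + d i"])
        (simp add: fun_eq_iff distrib_right sum.distrib)
  qed
  show "mtx_scale r M \<in> range ?L" if "M \<in> range ?L" for r M
  proof -
    from that obtain c where "M = ?L c"
      by blast
    then show ?thesis
      by (intro range_eqI[of _ _ "\<lambda>i. r * c i"])
        (simp add: mtx_scale_def sum_distrib_left mult.assoc)
  qed
qed

lemma sum_of_bool_mult:
  fixes f :: "'i \<Rightarrow> 'b::semiring_1"
  assumes "finite I" and "j \<in> I"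
  shows "(\<Sum>i\<in>I. of_bool (i = j) * f i) = f j"
  using assms by (simp add: of_bool_def if_distrib[of "\<lambda>t. t * _"] cong: if_cong)

lemma span_mtx_image:
  fixes A :: "'i \<Rightarrow> 'a mtx"
  assumes "finite I"
  shows "mtx.span (A ` I) = range (\<lambda>c x y. \<Sum>i\<in>I. c i * A i x y)" (is "_ = range ?L")
proof (rule equalityI)
  show "mtx.span (A ` I) \<subseteq> range ?L"
  proof (rule mtx.span_minimal[OF image_subsetI subspace_mtx_combinations])
    show "A j \<in> range ?L" if "j \<in> I" for j
      using assms that by (intro range_eqI[of _ _ "\<lambda>i. of_bool (i = j)"])
        (simp add: sum_of_bool_mult)
  qed
  have "?L c = (\<Sum>i\<in>I. mtx_scale (c i) (A i))" for c
    by (simp add: fun_eq_iff sum_mtx_apply mtx_scale_def)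
  moreover have "(\<Sum>i\<in>I. mtx_scale (c i) (A i)) \<in> mtx.span (A ` I)" for c
    by (intro mtx.span_sum mtx.span_scale mtx.span_base imageI)
  ultimately show "range ?L \<subseteq> mtx.span (A ` I)"
    by auto
qed

section \<open>Association schemes from orthogonal idempotents\<close>

locale orthogonal_idempotents =
  fixes X :: "'a set" and D :: nat and E :: "nat \<Rightarrow> 'a mtx"
  assumes orthogonal: "\<And>i j. i \<le> D \<Longrightarrow> j \<le> D \<Longrightarrow>
      mtx_mult X (E i) (E j) = (if i = j then E i else mtx_zero)"
    and nonzero: "\<And>i. i \<le> D \<Longrightarrow> E i \<noteq> mtx_zero"
begin

definition comb :: "(nat \<Rightarrow> real) \<Rightarrow> 'a mtx" where
  "comb c = (\<lambda>x y. \<Sum>k\<le>D. c k * E k x y)"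

abbreviation unit :: "nat \<Rightarrow> nat \<Rightarrow> real" where
  "unit j \<equiv> \<lambda>k. of_bool (k = j)"

lemma mult_comb: "mtx_mult X (comb c) (comb d) = comb (\<lambda>k. c k * d k)"
proof (intro ext)
  fix x y
  have "mtx_mult X (comb c) (comb d) x y
      = (\<Sum>z\<in>X. \<Sum>i\<le>D. \<Sum>j\<le>D. c i * d j * (E i x z * E j z y))"
    by (simp add: mtx_mult_def comb_def sum_product mult_ac)
  also have "\<dots> = (\<Sum>i\<le>D. \<Sum>j\<le>D. \<Sum>z\<in>X. c i * d j * (E i x z * E j z y))"
    by (subst sum.swap, intro sum.cong refl sum.swap)
  also have "\<dots> = (\<Sum>i\<le>D. \<Sum>j\<le>D. c i * d j * mtx_mult X (E i) (E j) x y)"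
    by (simp add: mtx_mult_def sum_distrib_left)
  also have "\<dots> = (\<Sum>i\<le>D. \<Sum>j\<le>D. if i = j then c i * d i * E i x y else 0)"
    by (intro sum.cong refl) (auto simp: orthogonal mtx_zero_def)
  also have "\<dots> = comb (\<lambda>k. c k * d k) x y"
    by (simp add: comb_def)
  finally show "mtx_mult X (comb c) (comb d) x y = comb (\<lambda>k. c k * d k) x y" .
qed

lemma comb_unit: "j \<le> D \<Longrightarrow> comb (unit j) = E j"
  by (simp add: comb_def sum_of_bool_mult)

lemma comb_add: "comb c + comb d = comb (\<lambda>k. c k + d k)"
  by (simp add: comb_def fun_eq_iff distrib_right sum.distrib)

lemma comb_eq_zero_iff: "comb c = mtx_zero \<longleftrightarrow> (\<forall>j\<le>D. c j = 0)"
proof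
  assume zero: "comb c = mtx_zero"
  show "\<forall>j\<le>D. c j = 0"
  proof (intro allI impI)
    fix j
    assume "j \<le> D"
    have "mtx_scale (c j) (E j) = comb (\<lambda>k. c j * unit j k)"
      unfolding comb_unit[OF \<open>j \<le> D\<close>, symmetric]
      by (simp only: mtx_scale_def comb_def sum_distrib_left mult.assoc)
    also have "(\<lambda>k. c j * unit j k) = (\<lambda>k. c k * unit j k)"
      by auto
    also have "comb \<dots> = mtx_mult X (comb c) (comb (unit j))"
      by (simp only: mult_comb)
    also have "\<dots> = mtx_zero"
      by (simp add: zero mtx_mult_def mtx_zero_def)
    finally show "c j = 0"
      using nonzero[OF \<open>j \<le> D\<close>] by (auto simp: mtx_scale_def mtx_zero_def fun_eq_iff)
  qed
qed (simp add: comb_def mtx_zero_def)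

lemma comb_eq_iff: "comb c = comb d \<longleftrightarrow> (\<forall>j\<le>D. c j = d j)"
proof -
  have "comb c = comb d \<longleftrightarrow> comb (\<lambda>k. c k - d k) = mtx_zero"
    by (simp add: comb_def mtx_zero_def fun_eq_iff left_diff_distrib sum_subtractf)
  then show ?thesis
    by (simp add: comb_eq_zero_iff)
qed

lemma inj_on_idempotents: "inj_on E {..D}"
proof (rule inj_onI)
  fix i j
  assume "i \<in> {..D}" "j \<in> {..D}" "E i = E j"
  then have "comb (unit i) = comb (unit j)"
    by (simp add: comb_unit)
  then show "i = j"
    using \<open>i \<in> {..D}\<close> by (auto simp: comb_eq_iff)
qed

lemma range_comb: "range comb = mtx.span (E ` {..D})"
  by (simp add: span_mtx_image comb_def[abs_def])

lemma independent_idempotents: "mtx.independent (E ` {..D})"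
proof (rule mtx.independent_if_scalars_zero)
  fix f M
  assume zero: "(\<Sum>M\<in>E ` {..D}. mtx_scale (f M) M) = 0" and M: "M \<in> E ` {..D}"
  have "comb (f \<circ> E) = (\<Sum>k\<le>D. mtx_scale (f (E k)) (E k))"
    by (simp add: comb_def mtx_scale_def sum_mtx_apply fun_eq_iff)
  also have "\<dots> = mtx_zero"
    using zero by (simp add: sum.reindex[OF inj_on_idempotents] mtx_zero_def zero_fun_def)
  finally show "f M = 0"
    using M by (auto simp: comb_eq_zero_iff)
qed simp

lemma comb_in_idempotents_iff:
  "comb c \<in> idempotents X (range comb) \<longleftrightarrow> (\<forall>j\<le>D. c j \<in> {0, 1})"
  by (auto simp: idempotents_def mult_comb comb_eq_iff)

lemma primitive_idempotent_unit:
  assumes "i \<le> D"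
  shows "comb (unit i) \<in> primitive_idempotents X (range comb)"
  unfolding primitive_idempotents_def
proof (intro CollectI conjI notI)
  show "comb (unit i) \<in> idempotents X (range comb)"
    by (simp add: comb_in_idempotents_iff)
  show "comb (unit i) = mtx_zero \<Longrightarrow> False"
    using assms by (auto simp: comb_eq_zero_iff)
  assume "\<exists>F\<in>idempotents X (range comb). \<exists>G\<in>idempotents X (range comb).
    F \<noteq> mtx_zero \<and> G \<noteq> mtx_zero \<and> mtx_mult X F G = mtx_zero \<and> mtx_mult X G F = mtx_zero \<and>
    comb (unit i) = (\<lambda>x y. F x y + G x y)"
  then obtain f g where fg:
      "comb f \<in> idempotents X (range comb)" "comb g \<in> idempotents X (range comb)"
      "comb f \<noteq> mtx_zero" "comb g \<noteq> mtx_zero" and sum: "comb (unit i) = comb f + comb g"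
    unfolding idempotents_def plus_fun_def by blast
  have f: "f j = 0 \<or> f j = 1" and g: "g j = 0 \<or> g j = 1" if "j \<le> D" for j
    using fg(1,2) that by (auto simp: comb_in_idempotents_iff)
  have unit_eq: "unit i j = f j + g j" if "j \<le> D" for j
    using sum that by (simp add: comb_add comb_eq_iff)
  obtain j where "j \<le> D" "f j = 1"
    using fg(3) f by (auto simp: comb_eq_zero_iff)
  then have "f i = 1"
    using unit_eq[of j] g[of j] by (cases "j = i") auto
  obtain k where "k \<le> D" "g k = 1"
    using fg(4) g by (auto simp: comb_eq_zero_iff)
  then have "g i = 1"
    using unit_eq[of k] f[of k] by (cases "k = i") auto
  then show False
    using \<open>f i = 1\<close> unit_eq[OF assms] by simp
qed

lemma primitive_idempotent_obtains_unit:
  assumes "F \<in> primitive_idempotents X (range comb)"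
  obtains i where "i \<le> D" "F = comb (unit i)"
proof -
  have F: "F \<in> idempotents X (range comb)" "F \<noteq> mtx_zero"
    using assms by (simp_all add: primitive_idempotents_def)
  then obtain f where f: "F = comb f" "\<forall>j\<le>D. f j \<in> {0, 1}"
    using comb_in_idempotents_iff by (auto simp: idempotents_def)
  then obtain i where i: "i \<le> D" "f i = 1"
    using F(2) by (auto simp: comb_eq_zero_iff)
  define g where "g = f(i := 0)"
  have "comb (unit i) \<in> idempotents X (range comb)" "comb g \<in> idempotents X (range comb)"
    using f by (simp_all add: comb_in_idempotents_iff g_def)
  moreover have "F = (\<lambda>x y. comb (unit i) x y + comb g x y)"
    using i comb_add[of "unit i" g] by (auto simp: f(1) plus_fun_def comb_eq_iff g_def)
  moreover have "mtx_mult X (comb (unit i)) (comb g) = mtx_zero"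
      "mtx_mult X (comb g) (comb (unit i)) = mtx_zero"
    by (auto simp: mult_comb comb_eq_zero_iff g_def)
  moreover have "comb (unit i) \<noteq> mtx_zero"
    using i by (auto simp: comb_eq_zero_iff)
  ultimately have "comb g = mtx_zero"
    using assms unfolding primitive_idempotents_def by blast
  then have "F = comb (unit i)"
    using i f(1) by (auto simp: comb_eq_iff comb_eq_zero_iff g_def)
  then show thesis
    using that i(1) by blast
qed

lemma primitive_idempotents_range_comb:
  "primitive_idempotents X (range comb) = E ` {..D}"
proof (intro equalityI subsetI)
  fix F
  assume "F \<in> primitive_idempotents X (range comb)"
  then obtain i where "i \<le> D" "F = comb (unit i)"
    by (rule primitive_idempotent_obtains_unit)
  then show "F \<in> E ` {..D}"
    by (simp add: comb_unit)
next
  fix F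
  assume "F \<in> E ` {..D}"
  then obtain i where "i \<le> D" "F = comb (unit i)"
    by (auto simp: comb_unit)
  then show "F \<in> primitive_idempotents X (range comb)"
    by (simp only: primitive_idempotent_unit)
qed

lemma krein_eqI:
  assumes "card X \<noteq> 0" and zero: "\<And>k. k > D \<Longrightarrow> c k = 0"
    and expansion: "\<And>x y. E i x y * E j x y = 1 / real (card X) * (\<Sum>k\<le>D. c k * E k x y)"
  shows "krein X D E i j = c"
  unfolding krein_def
proof (rule the_equality)
  show "(\<forall>k>D. c k = 0) \<and>
      (\<lambda>x y. E i x y * E j x y) = (\<lambda>x y. 1 / real (card X) * (\<Sum>k\<le>D. c k * E k x y))"
    using zero expansion by blast
next
  fix d
  assume d: "(\<forall>k>D. d k = 0) \<and>
      (\<lambda>x y. E i x y * E j x y) = (\<lambda>x y. 1 / real (card X) * (\<Sum>k\<le>D. d k * E k x y))"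
  then have "(\<lambda>x y. 1 / real (card X) * comb d x y) = (\<lambda>x y. 1 / real (card X) * comb c x y)"
    by (simp add: expansion comb_def)
  then have "comb d = comb c"
    using \<open>card X \<noteq> 0\<close> by (simp add: fun_eq_iff)
  then show "d = c"
    using d zero by (metis comb_eq_iff ext not_le)
qed

end

locale idempotent_scheme = orthogonal_idempotents X D E
  for X :: "'a set" and D :: nat and E :: "nat \<Rightarrow> 'a mtx" +
  fixes R :: "nat \<Rightarrow> ('a \<times> 'a) set"
  assumes finite: "finite X"
    and rel_subset: "\<And>i. i \<le> D \<Longrightarrow> R i \<subseteq> X \<times> X"
    and rel_0: "R 0 = Id_on X"
    and rel_partition: "\<And>x y. x \<in> X \<Longrightarrow> y \<in> X \<Longrightarrow> \<exists>!i. i \<le> D \<and> (x, y) \<in> R i"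
    and rel_sym: "\<And>i. i \<le> D \<Longrightarrow> sym (R i)"
    and idempotent_support: "\<And>j x y. j \<le> D \<Longrightarrow> (x, y) \<notin> X \<times> X \<Longrightarrow> E j x y = 0"
    and idempotent_const: "\<And>i j x y x' y'. i \<le> D \<Longrightarrow> j \<le> D \<Longrightarrow>
      (x, y) \<in> R i \<Longrightarrow> (x', y') \<in> R i \<Longrightarrow> E j x y = E j x' y'"
begin

abbreviation A :: "nat \<Rightarrow> 'a mtx" where
  "A i \<equiv> adjacency (R i)"

lemma nonempty: "X \<noteq> {}"
  using idempotent_support[of 0] nonzero[of 0] by (fastforce simp: mtx_zero_def)

lemma sum_adjacency:
  assumes "k \<le> D" and "(x, y) \<in> R k"
  shows "(\<Sum>i\<le>D. c i * A i x y) = c k"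
proof -
  have "(x, y) \<in> R i \<longleftrightarrow> i = k" if "i \<le> D" for i
    using assms that rel_subset rel_partition by blast
  then have "(\<Sum>i\<le>D. c i * A i x y) = (\<Sum>i\<le>D. if i = k then c i else 0)"
    by (intro sum.cong refl) (auto simp: adjacency_def)
  then show ?thesis
    using assms by simp
qed

lemma sum_adjacency_outside:
  "(x, y) \<notin> X \<times> X \<Longrightarrow> (\<Sum>i\<le>D. c i * A i x y) = 0"
  using rel_subset by (intro sum.neutral) (auto simp: adjacency_def)

lemma adjacency_algebra_span: "adjacency_algebra D R = mtx.span (A ` {..D})"
  by (auto simp: adjacency_algebra_def span_mtx_image)

lemma idempotent_in_adjacency_algebra:
  assumes "j \<le> D"
  shows "E j \<in> adjacency_algebra D R"
proof -
  have "\<exists>v. \<forall>x y. (x, y) \<in> R i \<longrightarrow> E j x y = v" if "i \<le> D" for i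
    using idempotent_const[OF that assms] by metis
  then obtain v where v: "\<And>i x y. i \<le> D \<Longrightarrow> (x, y) \<in> R i \<Longrightarrow> E j x y = v i"
    by metis
  have "E j x y = (\<Sum>i\<le>D. v i * A i x y)" for x y
  proof (cases "(x, y) \<in> X \<times> X")
    case True
    then obtain k where "k \<le> D" "(x, y) \<in> R k"
      using rel_partition by blast
    then show ?thesis
      by (simp add: sum_adjacency v)
  next
    case False
    then show ?thesis
      unfolding sum_adjacency_outside[OF False] by (rule idempotent_support[OF assms])
  qed
  then have "E j = (\<lambda>x y. \<Sum>i\<le>D. v i * A i x y)"
    by blast
  then show ?thesis
    by (auto simp: adjacency_algebra_def)
qed

text \<open>
  The \<open>D + 1\<close> independent idempotents lie in the span of the \<open>D + 1\<close> adjacency matrices, so both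
  families are bases of the same space; in particular no relation is empty.
\<close>

lemma
  shows range_comb_eq_adjacency_algebra: "range comb = adjacency_algebra D R"
    and independent_adjacency: "mtx.independent (A ` {..D})"
proof -
  have in_span: "E ` {..D} \<subseteq> mtx.span (A ` {..D})"
    using idempotent_in_adjacency_algebra by (simp add: image_subset_iff adjacency_algebra_span)
  have "card (A ` {..D}) \<le> card {..D}"
    by (rule card_image_le) simp
  also have "\<dots> = card (E ` {..D})"
    by (rule card_image[OF inj_on_idempotents, symmetric])
  finally have card_le: "card (A ` {..D}) \<le> card (E ` {..D})" .
  note basis = finite_imageI[OF finite_atMost] independent_idempotents in_span card_le
  show "range comb = adjacency_algebra D R"
    unfolding range_comb adjacency_algebra_span
    by (rule mtx.span_eq_if_card_le_independent[OF basis])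
  show "mtx.independent (A ` {..D})"
    by (rule mtx.independent_if_card_le_independent[OF basis])
qed

lemma rel_nonempty:
  assumes "i \<le> D"
  shows "R i \<noteq> {}"
proof
  assume "R i = {}"
  then have "0 = A i"
    by (intro ext) (simp add: adjacency_def)
  then have "0 \<in> A ` {..D}"
    using assms by (intro image_eqI) auto
  then show False
    using independent_adjacency mtx.dependent_zero by metis
qed

lemma mult_adjacency:
  "mtx_mult X (adjacency S) (adjacency T) x y = real (card {z \<in> X. (x, z) \<in> S \<and> (z, y) \<in> T})"
proof -
  have "mtx_mult X (adjacency S) (adjacency T) x y
      = (\<Sum>z\<in>X. of_bool ((x, z) \<in> S \<and> (z, y) \<in> T))"
    by (simp add: mtx_mult_def adjacency_def of_bool_conj)
  also have "\<dots> = real (card {z \<in> X. (x, z) \<in> S \<and> (z, y) \<in> T})"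
    using finite by (simp add: sum.If_cases of_bool_def Int_def)
  finally show ?thesis .
qed

lemma intersection_numbers:
  assumes "i \<le> D" and "j \<le> D"
  shows "\<exists>p :: nat \<Rightarrow> nat. mtx_mult X (A i) (A j) =
    (\<lambda>x y. \<Sum>k\<le>D. real (p k) * A k x y)"
proof -
  let ?M = "mtx_mult X (A i) (A j)"
  have "\<exists>c. A k = comb c" if "k \<le> D" for k
  proof -
    have "A k \<in> mtx.span (A ` {..D})"
      using that by (intro mtx.span_base) simp
    then show ?thesis
      by (auto simp flip: adjacency_algebra_span range_comb_eq_adjacency_algebra)
  qed
  then obtain a b where "A i = comb a" "A j = comb b"
    using assms by metis
  then have "?M \<in> range comb"
    by (simp add: mult_comb)
  then obtain c where c: "?M = (\<lambda>x y. \<Sum>k\<le>D. c k * A k x y)"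
    unfolding range_comb_eq_adjacency_algebra adjacency_algebra_def by blast
  have "\<exists>m :: nat. c k = real m" if "k \<le> D" for k
  proof -
    obtain x y where "(x, y) \<in> R k"
      using rel_nonempty[OF \<open>k \<le> D\<close>] by fastforce
    then have "c k = ?M x y"
      by (simp only: c sum_adjacency[OF \<open>k \<le> D\<close>])
    then show ?thesis
      by (auto simp: mult_adjacency)
  qed
  then obtain p :: "nat \<Rightarrow> nat" where "\<And>k. k \<le> D \<Longrightarrow> c k = real (p k)"
    by metis
  then show ?thesis
    unfolding c by (intro exI[of _ p] ext sum.cong) auto
qed

lemma association_scheme: "association_scheme X D R"
  unfolding association_scheme_def
proof (intro conjI allI impI)
  show "A 0 = mtx_one X"
    by (auto simp: adjacency_def mtx_one_def rel_0 fun_eq_iff Id_on_iff)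
  show "(\<lambda>x y. \<Sum>i\<le>D. A i x y) = mtx_all_ones X"
  proof (intro ext)
    fix x y
    show "(\<Sum>i\<le>D. A i x y) = mtx_all_ones X x y"
    proof (cases "(x, y) \<in> X \<times> X")
      case True
      then obtain k where "k \<le> D" "(x, y) \<in> R k"
        using rel_partition by blast
      with True show ?thesis
        using sum_adjacency[of k x y "\<lambda>_. 1"] by (simp add: mtx_all_ones_def)
    next
      case False
      then show ?thesis
        using sum_adjacency_outside[of x y "\<lambda>_. 1"] by (auto simp: mtx_all_ones_def)
    qed
  qed
  show "(\<lambda>x y. A i y x) = A i" if "i \<le> D" for i
    using rel_sym[OF that] by (auto simp: adjacency_def fun_eq_iff dest: symD)
  define p where "p i j = (SOME p :: nat \<Rightarrow> nat.
      mtx_mult X (A i) (A j) = (\<lambda>x y. \<Sum>k\<le>D. real (p k) * A k x y))" for i j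
  have "mtx_mult X (A i) (A j) = (\<lambda>x y. \<Sum>k\<le>D. real (p i j k) * A k x y)" if "i \<le> D" "j \<le> D" for i j
    using someI_ex[OF intersection_numbers[OF that]] by (simp only: p_def)
  then show "\<exists>p :: nat \<Rightarrow> nat \<Rightarrow> nat \<Rightarrow> nat. \<forall>i\<le>D. \<forall>j\<le>D.
      mtx_mult X (A i) (A j) = (\<lambda>x y. \<Sum>k\<le>D. real (p i j k) * A k x y)"
    by (intro exI[of _ p]) simp
qed (fact finite nonempty rel_nonempty rel_subset)+

lemma idempotent_orderingI:
  "E 0 = (\<lambda>x y. mtx_all_ones X x y / real (card X)) \<Longrightarrow> idempotent_ordering X D R E"
  by (simp add: idempotent_ordering_def bij_betw_def inj_on_idempotents
      primitive_idempotents_range_comb flip: range_comb_eq_adjacency_algebra)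

end

section \<open>Orthogonal arrays\<close>

lemma nths_eq_iff:
  assumes "length x = n" "length y = n" "T \<subseteq> {..<n}"
  shows "nths x T = nths y T \<longleftrightarrow> (\<forall>k\<in>T. x ! k = y ! k)"
proof -
  have "nths z T = map ((!) z) (nths [0..<n] T)" if "length z = n" for z :: "'a list"
    using that by (metis map_nth nths_map)
  moreover have "set (nths [0..<n] T) = T"
  proof -
    have "set (nths [0..<n] T) = (!) [0..<n] ` T"
      using assms(3) by (auto simp: set_nths)
    also have "\<dots> = id ` T"
      using assms(3) by (intro image_cong) auto
    finally show ?thesis
      by simp
  qed
  ultimately show ?thesis
    using assms by simp
qed

lemma finite_words: "finite (words n q)"
  using finite_lists_length_eq[of "{1..q}" n] by (simp add: words_def conj_commute)

lemma hamming_design_finite: "hamming_design t n q C \<Longrightarrow> finite C"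
  unfolding hamming_design_def using finite_subset finite_words by blast

lemma hamming_design_card_cylinder:
  assumes design: "hamming_design t n q C" and U: "U \<subseteq> {..<n}" "card U = t"
  shows "\<exists>m. \<forall>w \<in> U \<rightarrow>\<^sub>E {1..q}. card {x \<in> C. \<forall>k\<in>U. x ! k = w k} = m"
proof -
  have C: "C \<subseteq> words n q"
    using design by (simp add: hamming_design_def)
  have "\<exists>m. \<forall>v \<in> words t q. card {x \<in> C. nths x U = v} = m"
    using design U by (simp add: hamming_design_def)
  then obtain m where m: "\<And>v. v \<in> words t q \<Longrightarrow> card {x \<in> C. nths x U = v} = m"
    by blast
  have "card {x \<in> C. \<forall>k\<in>U. x ! k = w k} = m" if w: "w \<in> U \<rightarrow>\<^sub>E {1..q}" for w
  proof -
    define v where "v = map w [0..<n]"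
    have v: "length v = n" "\<And>k. k \<in> U \<Longrightarrow> v ! k = w k"
      using U by (auto simp: v_def)
    have "{k. k < n \<and> k \<in> U} = U"
      using U by auto
    then have "length (nths v U) = t"
      using U(2) v(1) by (simp add: length_nths)
    moreover have "set (nths v U) \<subseteq> {1..q}"
      using v(2) PiE_mem[OF w] by (auto simp: set_nths)
    ultimately have "nths v U \<in> words t q"
      by (simp add: words_def)
    moreover have "{x \<in> C. \<forall>k\<in>U. x ! k = w k} = {x \<in> C. nths x U = nths v U}"
      using C U v nths_eq_iff[of _ n v U] by (auto simp: words_def)
    ultimately show ?thesis
      using m by simp
  qed
  then show ?thesis
    by blast
qed

lemma hamming_design_sum_prod_card_eq:
  assumes design: "hamming_design t n q C" and U: "U \<subseteq> {..<n}" "card U = t"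
  shows "\<exists>m. \<forall>f :: nat \<Rightarrow> nat \<Rightarrow> real.
    (\<Sum>z\<in>C. \<Prod>k\<in>U. f k (z ! k)) = real m * (\<Prod>k\<in>U. \<Sum>a=1..q. f k a)"
proof -
  obtain m where m: "\<And>w. w \<in> U \<rightarrow>\<^sub>E {1..q} \<Longrightarrow> card {x \<in> C. \<forall>k\<in>U. x ! k = w k} = m"
    using hamming_design_card_cylinder[OF assms] by blast
  have C: "C \<subseteq> words n q" "finite C"
    using design hamming_design_finite[OF design] by (simp_all add: hamming_design_def)
  have finU: "finite U"
    using U(1) finite_subset by blast
  have "(\<Sum>z\<in>C. \<Prod>k\<in>U. f k (z ! k)) = real m * (\<Prod>k\<in>U. \<Sum>a=1..q. f k a)" for f :: "nat \<Rightarrow> nat \<Rightarrow> real"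
  proof -
    let ?r = "\<lambda>z. restrict ((!) z) U"
    have r_image: "?r ` C \<subseteq> U \<rightarrow>\<^sub>E {1..q}"
      using C U by (force simp: words_def)
    have fibre: "{z \<in> C. ?r z = w} = {z \<in> C. \<forall>k\<in>U. z ! k = w k}" if "w \<in> U \<rightarrow>\<^sub>E {1..q}" for w
      using that by (auto simp: fun_eq_iff restrict_def PiE_def extensional_def)
    have "(\<Sum>z\<in>C. \<Prod>k\<in>U. f k (z ! k))
        = (\<Sum>w\<in>U \<rightarrow>\<^sub>E {1..q}. \<Sum>z\<in>{z \<in> C. ?r z = w}. \<Prod>k\<in>U. f k (z ! k))"
      using C finU r_image by (intro sum.group[symmetric] finite_PiE) auto
    also have "\<dots> = (\<Sum>w\<in>U \<rightarrow>\<^sub>E {1..q}. \<Sum>z\<in>{z \<in> C. ?r z = w}. \<Prod>k\<in>U. f k (w k))"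
      by (intro sum.cong prod.cong refl) auto
    also have "\<dots> = (\<Sum>w\<in>U \<rightarrow>\<^sub>E {1..q}. real m * (\<Prod>k\<in>U. f k (w k)))"
      by (intro sum.cong refl) (simp add: fibre m)
    also have "\<dots> = real m * (\<Prod>k\<in>U. \<Sum>a=1..q. f k a)"
      using finU by (subst prod_sum_PiE) (auto simp: sum_distrib_left)
    finally show ?thesis .
  qed
  then show ?thesis
    by blast
qed

lemma hamming_design_sum_prod:
  fixes f :: "nat \<Rightarrow> nat \<Rightarrow> real"
  assumes design: "hamming_design t n q C" and T: "T \<subseteq> {..<n}" "card T \<le> t" and "q > 0"
  shows "(\<Sum>z\<in>C. \<Prod>k\<in>T. f k (z ! k)) = real (card C) * (\<Prod>k\<in>T. (\<Sum>a=1..q. f k a) / real q)"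
proof -
  have "t \<le> n"
    using design by (simp add: hamming_design_def)
  then obtain U where U: "T \<subseteq> U" "U \<subseteq> {..<n}" "card U = t"
    using exists_subset_between[of T t "{..<n}"] T by auto
  then have "finite U"
    using finite_subset by blast
  obtain m where m: "\<forall>f :: nat \<Rightarrow> nat \<Rightarrow> real.
      (\<Sum>z\<in>C. \<Prod>k\<in>U. f k (z ! k)) = real m * (\<Prod>k\<in>U. \<Sum>a=1..q. f k a)"
    using hamming_design_sum_prod_card_eq[OF design U(2,3)] ..
  have card_C: "real (card C) = real m * real q ^ card U"
    using m[rule_format, of "\<lambda>_ _. 1"] by simp
  define g where "g = (\<lambda>k a. if k \<in> T then f k a else 1)"
  have "(\<Sum>z\<in>C. \<Prod>k\<in>T. f k (z ! k)) = (\<Sum>z\<in>C. \<Prod>k\<in>U. g k (z ! k))"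
    using U \<open>finite U\<close> unfolding g_def by (intro sum.cong refl prod.mono_neutral_cong_left) auto
  also have "\<dots> = real m * (\<Prod>k\<in>U. real q * ((\<Sum>a=1..q. g k a) / real q))"
    using m[rule_format, of g] \<open>q > 0\<close> by simp
  also have "\<dots> = real (card C) * (\<Prod>k\<in>U. (\<Sum>a=1..q. g k a) / real q)"
    by (simp only: prod.distrib card_C prod_constant mult.assoc)
  also have "(\<Prod>k\<in>U. (\<Sum>a=1..q. g k a) / real q) = (\<Prod>k\<in>T. (\<Sum>a=1..q. f k a) / real q)"
    using U \<open>finite U\<close> \<open>q > 0\<close> unfolding g_def by (intro prod.mono_neutral_cong_right) auto
  finally show ?thesis .
qed

section \<open>Projection kernels\<close>

definition centred_delta :: "nat \<Rightarrow> 'a \<Rightarrow> 'a \<Rightarrow> real" where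
  "centred_delta q a b = real q * of_bool (a = b) - 1"

lemma centred_delta_commute: "centred_delta q a b = centred_delta q b a"
  by (simp add: centred_delta_def eq_commute)

lemma centred_delta_same: "centred_delta q a a = real q - 1"
  by (simp add: centred_delta_def)

lemma centred_delta_squared:
  "(centred_delta q a b)\<^sup>2 = (real q - 2) * centred_delta q a b + (real q - 1)"
  by (simp add: centred_delta_def power2_eq_square algebra_simps)

lemma sum_centred_delta:
  assumes "b \<in> {1..q}"
  shows "(\<Sum>a=1..q. centred_delta q b a) = 0"
proof -
  have "(\<Sum>a=1..q. of_bool (b = a)) = (1 :: real)"
    using assms by (simp add: of_bool_def)
  then show ?thesis
    by (simp add: centred_delta_def sum_subtractf flip: sum_distrib_left)
qed

lemma sum_centred_delta_mult:
  assumes "b \<in> {1..q}" and "c \<in> {1..q}"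
  shows "(\<Sum>a=1..q. centred_delta q b a * centred_delta q a c) = real q * centred_delta q b c"
proof -
  have "(\<Sum>a=1..q. centred_delta q b a * centred_delta q a c)
      = (\<Sum>a=1..q. real q * of_bool (b = a) * centred_delta q b c - centred_delta q c a)"
    by (intro sum.cong refl) (auto simp: centred_delta_def algebra_simps)
  also have "\<dots> = real q * (\<Sum>a=1..q. of_bool (b = a)) * centred_delta q b c"
    using sum_centred_delta[OF assms(2)]
    by (simp add: sum_subtractf flip: sum_distrib_left sum_distrib_right)
  also have "\<dots> = real q * centred_delta q b c"
    using assms(1) by (simp add: of_bool_def)
  finally show ?thesis .
qed

text \<open>
  The kernel of the orthogonal projection onto the functions on \<open>V\<^sup>n\<close> that depend only on the
  coordinates in \<open>T\<close> and have mean \<open>0\<close> in each of them, up to the factor \<open>q\<^sup>n\<close>.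
\<close>

definition chi :: "nat \<Rightarrow> nat set \<Rightarrow> 'a list \<Rightarrow> 'a list \<Rightarrow> real" where
  "chi q T x y = (\<Prod>k\<in>T. centred_delta q (x ! k) (y ! k))"

definition chi_factor ::
  "nat \<Rightarrow> nat set \<Rightarrow> nat set \<Rightarrow> 'a list \<Rightarrow> 'a list \<Rightarrow> nat \<Rightarrow> 'a \<Rightarrow> real" where
  "chi_factor q S T x y k a = (if k \<in> S then centred_delta q (x ! k) a else 1) *
    (if k \<in> T then centred_delta q a (y ! k) else 1)"

lemma chi_mult_chi:
  assumes "finite (S \<union> T)"
  shows "chi q S x z * chi q T z y = (\<Prod>k\<in>S \<union> T. chi_factor q S T x y k (z ! k))"
proof -
  have "chi q S x z = (\<Prod>k\<in>S \<union> T. if k \<in> S then centred_delta q (x ! k) (z ! k) else 1)"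
    unfolding chi_def using assms by (intro prod.mono_neutral_cong_left) auto
  moreover have "chi q T z y = (\<Prod>k\<in>S \<union> T. if k \<in> T then centred_delta q (z ! k) (y ! k) else 1)"
    unfolding chi_def using assms by (intro prod.mono_neutral_cong_left) auto
  ultimately show ?thesis
    by (simp add: chi_factor_def prod.distrib)
qed

lemma sum_chi_factor:
  assumes "k \<in> S \<union> T" and "x ! k \<in> {1..q}" and "y ! k \<in> {1..q}"
  shows "(\<Sum>a=1..q. chi_factor q S T x y k a)
    = real q * of_bool (k \<in> S \<inter> T) * centred_delta q (x ! k) (y ! k)"
  using assms(1) sum_centred_delta[OF assms(2)] sum_centred_delta[OF assms(3)]
    sum_centred_delta_mult[OF assms(2,3)]
  by (auto simp: chi_factor_def centred_delta_commute[of q _ "y ! k"])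

lemma chi_convolution:
  assumes design: "hamming_design t n q C" and S: "S \<subseteq> {..<n}" and T: "T \<subseteq> {..<n}"
    and "card (S \<union> T) \<le> t" and "q > 0" and "x \<in> words n q" and "y \<in> words n q"
  shows "(\<Sum>z\<in>C. chi q S x z * chi q T z y) = real (card C) * of_bool (S = T) * chi q S x y"
proof -
  have fin: "finite (S \<union> T)"
    using S T finite_subset by blast
  have letter: "u ! k \<in> {1..q}" if "u \<in> words n q" "k \<in> S \<union> T" for u k
  proof -
    have "k < length u"
      using that S T by (auto simp: words_def)
    then show ?thesis
      using that(1) nth_mem by (fastforce simp: words_def)
  qed
  have "(\<Sum>z\<in>C. chi q S x z * chi q T z y)
      = (\<Sum>z\<in>C. \<Prod>k\<in>S \<union> T. chi_factor q S T x y k (z ! k))"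
    by (simp only: chi_mult_chi[OF fin])
  also have "\<dots> = real (card C) * (\<Prod>k\<in>S \<union> T. (\<Sum>a=1..q. chi_factor q S T x y k a) / real q)"
    using S T assms(4,5) by (intro hamming_design_sum_prod[OF design]) simp_all
  also have "(\<Prod>k\<in>S \<union> T. (\<Sum>a=1..q. chi_factor q S T x y k a) / real q)
      = (\<Prod>k\<in>S \<union> T. of_bool (k \<in> S \<inter> T) * centred_delta q (x ! k) (y ! k))"
    using assms(5-7) letter by (intro prod.cong refl) (simp only: sum_chi_factor, simp)
  also have "\<dots> = of_bool (S = T) * chi q S x y"
  proof (cases "S = T")
    case False
    then obtain k where "k \<in> S \<union> T" "k \<notin> S \<inter> T"
      by blast
    then have "(\<Prod>k\<in>S \<union> T. of_bool (k \<in> S \<inter> T) * centred_delta q (x ! k) (y ! k)) = 0"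
      using fin by (intro prod_zero) auto
    then show ?thesis
      using False by simp
  qed (simp add: chi_def)
  finally show ?thesis
    by simp
qed

definition chi_sum :: "nat \<Rightarrow> nat set set \<Rightarrow> 'a list \<Rightarrow> 'a list \<Rightarrow> real" where
  "chi_sum q \<S> x y = (\<Sum>T\<in>\<S>. chi q T x y)"

lemma chi_sum_commute: "chi_sum q \<S> x y = chi_sum q \<S> y x"
  by (simp add: chi_sum_def chi_def centred_delta_commute)

lemma chi_sum_same: "chi_sum q \<S> x x = (\<Sum>T\<in>\<S>. (real q - 1) ^ card T)"
  by (simp add: chi_sum_def chi_def centred_delta_same)

lemma chi_sum_UN_disjoint:
  assumes "finite I" and "\<And>i. i \<in> I \<Longrightarrow> finite (\<S> i)"
    and "\<And>i j. i \<in> I \<Longrightarrow> j \<in> I \<Longrightarrow> i \<noteq> j \<Longrightarrow> \<S> i \<inter> \<S> j = {}"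
  shows "chi_sum q (\<Union>i\<in>I. \<S> i) x y = (\<Sum>i\<in>I. chi_sum q (\<S> i) x y)"
  unfolding chi_sum_def using assms by (intro sum.UNION_disjoint) auto

lemma chi_sum_image_insert:
  assumes "\<And>T. T \<in> \<S> \<Longrightarrow> finite T \<and> a \<notin> T"
  shows "chi_sum q (insert a ` \<S>) x y = centred_delta q (x ! a) (y ! a) * chi_sum q \<S> x y"
proof -
  have "inj_on (insert a) \<S>"
    using assms by (auto simp: inj_on_def insert_ident)
  then have "chi_sum q (insert a ` \<S>) x y = (\<Sum>T\<in>\<S>. chi q (insert a T) x y)"
    by (simp add: chi_sum_def sum.reindex)
  also have "\<dots> = (\<Sum>T\<in>\<S>. centred_delta q (x ! a) (y ! a) * chi q T x y)"
    using assms by (intro sum.cong refl) (simp add: chi_def)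
  finally show ?thesis
    by (simp add: chi_sum_def sum_distrib_left)
qed

lemma chi_sum_nsets_0: "chi_sum q (nsets A 0) x y = 1"
  by (simp add: chi_sum_def chi_def)

lemma chi_sum_nsets_1: "chi_sum q (nsets A 1) x y = (\<Sum>k\<in>A. centred_delta q (x ! k) (y ! k))"
  by (simp add: chi_sum_def chi_def nsets_one sum.reindex)

lemma chi_sum_nsets_1_eq_card:
  assumes "finite A"
  shows "chi_sum q (nsets A 1) x y
    = real (card A) * (real q - 1) - real q * real (card {k \<in> A. x ! k \<noteq> y ! k})"
proof -
  have "chi_sum q (nsets A 1) x y = (\<Sum>k\<in>A. (real q - 1) - real q * of_bool (x ! k \<noteq> y ! k))"
    unfolding chi_sum_nsets_1 by (intro sum.cong) (auto simp: centred_delta_def)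
  also have "\<dots> = real (card A) * (real q - 1) - real q * (\<Sum>k\<in>A. of_bool (x ! k \<noteq> y ! k))"
    by (simp add: sum_subtractf sum_distrib_left)
  also have "(\<Sum>k\<in>A. of_bool (x ! k \<noteq> y ! k)) = real (card {k \<in> A. x ! k \<noteq> y ! k})"
    using assms by (simp add: of_bool_def sum.If_cases Int_def)
  finally show ?thesis .
qed

lemma sum_nsets_insert:
  fixes g :: "'a set \<Rightarrow> 'b::comm_monoid_add"
  assumes "finite A" and "a \<notin> A"
  shows "(\<Sum>T\<in>nsets (insert a A) (Suc k). g T)
    = (\<Sum>T\<in>nsets A (Suc k). g T) + (\<Sum>T\<in>nsets A k. g (insert a T))"
proof -
  have a: "a \<notin> T" if "T \<in> nsets A j" for T j
    using that assms(2) by (auto simp: nsets_def)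
  have "nsets (insert a A) (Suc k) = nsets A (Suc k) \<union> insert a ` nsets A k"
  proof (intro equalityI subsetI)
    fix T
    assume T: "T \<in> nsets (insert a A) (Suc k)"
    show "T \<in> nsets A (Suc k) \<union> insert a ` nsets A k"
    proof (cases "a \<in> T")
      case True
      then have "T = insert a (T - {a})" "T - {a} \<in> nsets A k"
        using T by (auto simp: nsets_def)
      then show ?thesis
        by blast
    qed (use T in \<open>auto simp: nsets_def\<close>)
  qed (use a in \<open>auto simp: nsets_def\<close>)
  moreover have "nsets A (Suc k) \<inter> insert a ` nsets A k = {}"
    using a by blast
  moreover have "inj_on (insert a) (nsets A k)"
    using a by (auto simp: inj_on_def insert_ident)
  ultimately show ?thesis
    using assms(1) by (simp add: finite_imp_finite_nsets sum.union_disjoint sum.reindex)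
qed

lemma sum_nsets_2_prod:
  fixes f :: "'a \<Rightarrow> 'b::comm_ring_1"
  assumes "finite A"
  shows "2 * (\<Sum>T\<in>nsets A 2. \<Prod>k\<in>T. f k) = (\<Sum>k\<in>A. f k)\<^sup>2 - (\<Sum>k\<in>A. (f k)\<^sup>2)"
  using assms
proof (induction A rule: finite_induct)
  case (insert a A)
  have "(\<Sum>T\<in>nsets A 1. \<Prod>k\<in>insert a T. f k) = (\<Sum>k\<in>A. f a * f k)"
    unfolding One_nat_def nsets_one using insert.hyps
    by (simp add: sum.reindex, intro sum.cong refl, subst prod.insert) auto
  then have "(\<Sum>T\<in>nsets (insert a A) 2. \<Prod>k\<in>T. f k)
      = (\<Sum>T\<in>nsets A 2. \<Prod>k\<in>T. f k) + f a * (\<Sum>k\<in>A. f k)"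
    using sum_nsets_insert[OF insert.hyps, of "prod f" 1]
    by (simp add: sum_distrib_left numeral_2_eq_2)
  then show ?case
    using insert by (simp add: distrib_left power2_sum)
qed (simp add: nsets_empty_iff)

lemma chi_sum_nsets_1_squared:
  assumes "finite A"
  shows "(chi_sum q (nsets A 1) x y)\<^sup>2 = 2 * chi_sum q (nsets A 2) x y
    + (real q - 2) * chi_sum q (nsets A 1) x y + real (card A) * (real q - 1)"
proof -
  have "(chi_sum q (nsets A 1) x y)\<^sup>2 = 2 * chi_sum q (nsets A 2) x y
      + (\<Sum>k\<in>A. (centred_delta q (x ! k) (y ! k))\<^sup>2)"
    unfolding chi_sum_nsets_1 by (simp add: chi_sum_def chi_def sum_nsets_2_prod[OF assms])
  also have "(\<Sum>k\<in>A. (centred_delta q (x ! k) (y ! k))\<^sup>2)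
      = (real q - 2) * chi_sum q (nsets A 1) x y + real (card A) * (real q - 1)"
    unfolding chi_sum_nsets_1 by (simp add: centred_delta_squared sum.distrib sum_distrib_left)
  finally show ?thesis
    by simp
qed

section \<open>Tight designs\<close>

definition small_supports :: "nat \<Rightarrow> nat \<Rightarrow> nat set set" where
  "small_supports n e = (\<Union>j\<le>e. nsets {..<n} j)"

lemma small_supports_iff: "T \<in> small_supports n e \<longleftrightarrow> T \<subseteq> {..<n} \<and> card T \<le> e"
  using finite_subset[OF _ finite_lessThan] by (auto simp: small_supports_def nsets_def)

lemma finite_small_supports: "finite (small_supports n e)"
  by (simp add: small_supports_def finite_imp_finite_nsets)

lemma chi_sum_small_supports:
  "chi_sum q (small_supports n e) x y = (\<Sum>j\<le>e. chi_sum q (nsets {..<n} j) x y)"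
  unfolding small_supports_def
  by (rule chi_sum_UN_disjoint) (auto simp: finite_imp_finite_nsets nsets_def)

lemma chi_sum_convolution:
  assumes design: "hamming_design (2 * e) n q C" and "q > 0"
    and sub: "\<S> \<subseteq> small_supports n e" "\<T> \<subseteq> small_supports n e"
    and x: "x \<in> words n q" and y: "y \<in> words n q"
  shows "(\<Sum>z\<in>C. chi_sum q \<S> x z * chi_sum q \<T> z y) = real (card C) * chi_sum q (\<S> \<inter> \<T>) x y"
proof -
  have fin: "finite \<S>" "finite \<T>"
    using sub finite_small_supports finite_subset by blast+
  have "(\<Sum>z\<in>C. chi_sum q \<S> x z * chi_sum q \<T> z y)
      = (\<Sum>z\<in>C. \<Sum>S\<in>\<S>. \<Sum>T\<in>\<T>. chi q S x z * chi q T z y)"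
    by (simp add: chi_sum_def sum_product)
  also have "\<dots> = (\<Sum>S\<in>\<S>. \<Sum>T\<in>\<T>. \<Sum>z\<in>C. chi q S x z * chi q T z y)"
    by (subst sum.swap, intro sum.cong refl sum.swap)
  also have "\<dots> = (\<Sum>S\<in>\<S>. \<Sum>T\<in>\<T>. real (card C) * of_bool (S = T) * chi q S x y)"
  proof (intro sum.cong refl chi_convolution[OF design _ _ _ \<open>q > 0\<close> x y])
    fix S T
    assume "S \<in> \<S>" "T \<in> \<T>"
    then have "S \<in> small_supports n e" "T \<in> small_supports n e"
      using sub by blast+
    then show "S \<subseteq> {..<n}" "T \<subseteq> {..<n}" "card (S \<union> T) \<le> 2 * e"
      using card_Un_le[of S T] by (auto simp: small_supports_iff)
  qed
  also have "\<dots> = (\<Sum>S\<in>\<S>. if S \<in> \<T> then real (card C) * chi q S x y else 0)"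
    using fin by (simp add: of_bool_def if_distrib if_distribR cong: if_cong)
  also have "\<dots> = real (card C) * chi_sum q (\<S> \<inter> \<T>) x y"
    using fin by (simp add: chi_sum_def sum_distrib_left flip: sum.inter_restrict)
  finally show ?thesis .
qed

lemma reproducing_kernel_eq_diagonal:
  fixes W :: "'a mtx"
  assumes "finite C" and "x \<in> C" and "y \<in> C"
    and sym: "\<And>z. z \<in> C \<Longrightarrow> W z x = W x z"
    and reproducing: "(\<Sum>z\<in>C. W x z * W z x) = N * W x x" and diag: "W x x = N"
  shows "W x y = N * of_bool (x = y)"
proof -
  have "(\<Sum>z\<in>C. (W x z)\<^sup>2) = (\<Sum>z\<in>C. W x z * W z x)"
    by (intro sum.cong refl) (simp only: sym power2_eq_square)
  also have "\<dots> = (W x x)\<^sup>2"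
    by (simp add: reproducing diag power2_eq_square)
  finally have "(\<Sum>z\<in>C - {x}. (W x z)\<^sup>2) = 0"
    using sum.remove[OF assms(1,2), of "\<lambda>z. (W x z)\<^sup>2"] by simp
  then have "\<forall>z\<in>C - {x}. (W x z)\<^sup>2 = 0"
    using assms(1) by (simp add: sum_nonneg_eq_0_iff)
  then show ?thesis
    using \<open>y \<in> C\<close> diag by (cases "x = y") auto
qed

lemma chi_sum_tight_design:
  assumes design: "hamming_design (2 * e) n q C"
    and card_C: "card C = (\<Sum>j\<le>e. (n choose j) * (q - 1) ^ j)"
    and "q > 0" and "x \<in> C" and "y \<in> C"
  shows "chi_sum q (small_supports n e) x y = real (card C) * of_bool (x = y)"
proof (rule reproducing_kernel_eq_diagonal[of C])
  show "finite C" "x \<in> C" "y \<in> C"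
    by (fact hamming_design_finite[OF design] assms)+
  show "chi_sum q (small_supports n e) z x = chi_sum q (small_supports n e) x z" for z
    by (rule chi_sum_commute)
  have "x \<in> words n q"
    using design \<open>x \<in> C\<close> by (auto simp: hamming_design_def)
  then show "(\<Sum>z\<in>C. chi_sum q (small_supports n e) x z * chi_sum q (small_supports n e) z x)
      = real (card C) * chi_sum q (small_supports n e) x x"
    using chi_sum_convolution[OF design \<open>q > 0\<close> subset_refl subset_refl] by simp
  have "chi_sum q (nsets {..<n} j) x x = real ((n choose j) * (q - 1) ^ j)" for j
  proof -
    have "chi_sum q (nsets {..<n} j) x x = (\<Sum>T\<in>nsets {..<n} j. (real q - 1) ^ j)"
      unfolding chi_sum_same by (intro sum.cong refl) (simp add: nsets_def)
    then show ?thesis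
      using \<open>q > 0\<close> by (simp add: of_nat_diff)
  qed
  then show "chi_sum q (small_supports n e) x x = real (card C)"
    by (simp add: chi_sum_small_supports card_C)
qed

section \<open>Puncturing a tight 4-design\<close>

lemma hamming_dist_commute: "length x = length y \<Longrightarrow> hamming_dist x y = hamming_dist y x"
  by (simp add: hamming_dist_def eq_commute)

lemma hamming_dist_eq_0_iff: "length x = length y \<Longrightarrow> hamming_dist x y = 0 \<longleftrightarrow> x = y"
  by (auto simp: hamming_dist_def intro: nth_equalityI)

lemma hamming_dist_tl:
  assumes "length x = length y"
  shows "hamming_dist (tl x) (tl y) = card {k \<in> {1..<length x}. x ! k \<noteq> y ! k}"
proof -
  have "{k \<in> {1..<length x}. x ! k \<noteq> y ! k} = Suc ` {k. k < length (tl x) \<and> tl x ! k \<noteq> tl y ! k}"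
  proof (intro equalityI subsetI)
    fix k
    assume "k \<in> {k \<in> {1..<length x}. x ! k \<noteq> y ! k}"
    then show "k \<in> Suc ` {k. k < length (tl x) \<and> tl x ! k \<noteq> tl y ! k}"
      using assms by (cases k) (auto simp: nth_tl)
  qed (use assms in \<open>auto simp: nth_tl\<close>)
  then show ?thesis
    by (simp add: hamming_dist_def card_image)
qed

lemma hamming_dist_eq_tl:
  assumes "length x = length y" and "x \<noteq> []"
  shows "hamming_dist x y = of_bool (x ! 0 \<noteq> y ! 0) + hamming_dist (tl x) (tl y)"
proof -
  define rest where "rest = {k \<in> {1..<length x}. x ! k \<noteq> y ! k}"
  have "finite rest" "0 \<notin> rest"
    by (simp_all add: rest_def)
  moreover have "{k. k < length x \<and> x ! k \<noteq> y ! k}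
      = (if x ! 0 \<noteq> y ! 0 then insert 0 rest else rest)"
    using assms(2) by (auto simp: rest_def Suc_le_eq intro: gr0I)
  moreover have "hamming_dist (tl x) (tl y) = card rest"
    unfolding rest_def by (rule hamming_dist_tl[OF assms(1)])
  ultimately show ?thesis
    by (simp add: hamming_dist_def[of x])
qed

lemma tilde_code_eq_image_tl:
  assumes "C \<subseteq> words n q" and "n > 0"
  shows "tilde_code q C = tl ` C"
proof (intro equalityI subsetI)
  fix x
  assume "x \<in> tilde_code q C"
  then obtain i where "i # x \<in> C"
    by (auto simp: tilde_code_def derived_code_def)
  then show "x \<in> tl ` C"
    by (intro image_eqI[of _ _ "i # x"]) simp_all
next
  fix x
  assume "x \<in> tl ` C"
  then obtain u where u: "u \<in> C" "x = tl u"
    by blast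
  then have "u \<in> words n q"
    using assms(1) by blast
  then have "hd u \<in> {1..q}" "u = hd u # x"
    using assms(2) u(2) by (cases u; auto simp: words_def)+
  then show "x \<in> tilde_code q C"
    using u(1) by (auto simp: tilde_code_def derived_code_def intro: bexI[of _ "hd u"])
qed

text \<open>
  In the \<open>Q\<close>-polynomial order: \<open>{}\<close>, \<open>{k}\<close>, \<open>{k, l}\<close>, \<open>{0, k}\<close>, \<open>{0}\<close> with \<open>k, l \<ge> 1\<close>, where \<open>0\<close> is
  the deleted coordinate. Only the indices \<open>j \<le> 4\<close> are meaningful.
\<close>

definition supports :: "nat \<Rightarrow> nat \<Rightarrow> nat set set" where
  "supports n j = (if j \<le> 2 then nsets {1..<n} j else insert 0 ` nsets {1..<n} (4 - j))"

lemma finite_supports: "finite (supports n j)"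
  by (simp add: supports_def finite_imp_finite_nsets)

lemma supports_nonempty: "n \<ge> 4 \<Longrightarrow> supports n j \<noteq> {}"
  by (auto simp: supports_def nsets_eq_empty_iff)

lemma supports_index:
  assumes "T \<in> supports n j" and "j \<le> 4"
  shows "j = (if 0 \<in> T then 5 - card T else card T)"
proof (cases "j \<le> 2")
  case False
  then obtain S where "S \<in> nsets {1..<n} (4 - j)" "T = insert 0 S"
    using assms(1) by (auto simp: supports_def)
  then have "card T = Suc (4 - j)" "0 \<in> T"
    by (auto simp: nsets_def card_insert_if)
  then show ?thesis
    using \<open>j \<le> 4\<close> by simp
qed (use assms in \<open>auto simp: supports_def nsets_def\<close>)

lemma supports_disjoint:
  assumes "i \<le> 4" and "j \<le> 4" and "i \<noteq> j"
  shows "supports n i \<inter> supports n j = {}"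
proof -
  have False if "T \<in> supports n i" "T \<in> supports n j" for T
    using supports_index[OF that(1) assms(1)] supports_index[OF that(2) assms(2)] assms(3) by simp
  then show ?thesis
    by blast
qed

lemma supports_subset:
  assumes "n > 0"
  shows "supports n j \<subseteq> small_supports n 2"
proof
  fix T
  assume T: "T \<in> supports n j"
  show "T \<in> small_supports n 2"
  proof (cases "j \<le> 2")
    case True
    then show ?thesis
      using T by (auto simp: supports_def small_supports_iff nsets_def)
  next
    case False
    then obtain S where "S \<subseteq> {1..<n}" "finite S" "card S = 4 - j" "T = insert 0 S"
      using T by (auto simp: supports_def nsets_def)
    then show ?thesis
      using assms False by (auto simp: small_supports_iff card_insert_if)
  qed
qed

lemma UN_supports:
  assumes "n > 0"
  shows "(\<Union>j\<le>4. supports n j) = small_supports n 2"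
proof (rule equalityI)
  show "(\<Union>j\<le>4. supports n j) \<subseteq> small_supports n 2"
    using supports_subset[OF assms] by (rule UN_least)
  show "small_supports n 2 \<subseteq> (\<Union>j\<le>4. supports n j)"
  proof
    fix T
    assume "T \<in> small_supports n 2"
    then have T: "T \<subseteq> {..<n}" "finite T" "card T \<le> 2"
      using finite_subset by (auto simp: small_supports_iff)
    define S where "S = T - {0}"
    have S: "S \<in> nsets {1..<n} (card S)"
      using T(1,2) by (auto simp: S_def nsets_def Suc_le_eq)
    show "T \<in> (\<Union>j\<le>4. supports n j)"
    proof (cases "0 \<in> T")
      case True
      then have "card S \<le> 1" "T = insert 0 S"
        using T by (auto simp: S_def)
      moreover from this have "\<not> 4 - card S \<le> 2" "4 - (4 - card S) = card S"
        by arith+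
      ultimately have "T \<in> supports n (4 - card S)"
        unfolding supports_def using S by simp
      then show ?thesis
        by (rule UN_I[rotated]) simp
    next
      case False
      then have "T \<in> supports n (card T)"
        using S T(3) by (simp add: S_def supports_def)
      then show ?thesis
        using T(3) by (intro UN_I[of "card T"]) simp_all
    qed
  qed
qed

lemma chi_sum_insert_0:
  "chi_sum q (insert 0 ` nsets {1..<n} j) x y
    = centred_delta q (x ! 0) (y ! 0) * chi_sum q (nsets {1..<n} j) x y"
  by (rule chi_sum_image_insert) (auto simp: nsets_def)

lemma chi_sum_supports_4: "chi_sum q (supports n 4) x y = centred_delta q (x ! 0) (y ! 0)"
  using chi_sum_insert_0[of q n 0 x y] unfolding supports_def chi_sum_nsets_0 by simp

lemma chi_sum_supports_3:
  "chi_sum q (supports n 3) x y = chi_sum q (supports n 4) x y * chi_sum q (supports n 1) x y"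
  unfolding chi_sum_supports_4 using chi_sum_insert_0[of q n 1 x y] by (simp add: supports_def)

lemma sum_atMost_4: "(\<Sum>j\<le>4. f j) = f 0 + f 1 + f 2 + f 3 + f (4 :: nat)"
  by (simp add: numeral_eq_Suc)

lemma le_4_cases:
  assumes "j \<le> (4 :: nat)"
  obtains (zero) "j = 0" | (one) "j = 1" | (two) "j = 2" | (three) "j = 3" | (four) "j = 4"
  using assms by linarith

locale tight_design =
  fixes n q \<alpha>1 \<alpha>2 :: nat and C :: "nat list set"
  assumes q_ge_2: "q \<ge> 2"
    and tight: "tight_4_design n q C"
    and degrees: "degree_set C = {\<alpha>1, \<alpha>2}" and degrees_less: "\<alpha>1 < \<alpha>2"
begin

lemma q_pos: "q > 0"
  using q_ge_2 by simp

lemma design: "hamming_design (2 * 2) n q C"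
  using tight by (simp add: tight_4_design_def)

lemma n_ge_4: "n \<ge> 4" and subset_words: "C \<subseteq> words n q"
  using design by (simp_all add: hamming_design_def)

lemma n_pos: "n > 0"
  using n_ge_4 by simp

lemma card_pos: "card C > 0"
  using tight by (simp add: tight_4_design_def)

lemma length_codeword: "u \<in> C \<Longrightarrow> length u = n"
  using subset_words by (auto simp: words_def)

lemma codeword_nonempty: "u \<in> C \<Longrightarrow> u \<noteq> []"
  using length_codeword n_pos by fastforce

lemma chi_sum_design:
  assumes "u \<in> C" and "v \<in> C"
  shows "chi_sum q (small_supports n 2) u v = real (card C) * of_bool (u = v)"
proof (rule chi_sum_tight_design[OF design _ q_pos assms])
  show "card C = (\<Sum>j\<le>2. (n choose j) * (q - 1) ^ j)"
    using tight by (simp add: tight_4_design_def numeral_2_eq_2)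
qed

lemma degree_cases:
  assumes "u \<in> C" and "v \<in> C" and "u \<noteq> v"
  shows "hamming_dist u v = \<alpha>1 \<or> hamming_dist u v = \<alpha>2"
proof -
  have "hamming_dist u v \<in> degree_set C"
    using assms by (auto simp: degree_set_def)
  then show ?thesis
    by (simp add: degrees)
qed

lemma degree_attained:
  assumes "d = \<alpha>1 \<or> d = \<alpha>2"
  obtains u v where "u \<in> C" "v \<in> C" "u \<noteq> v" "d = hamming_dist u v"
proof -
  have "d \<in> degree_set C"
    using assms by (simp add: degrees)
  then show thesis
    using that by (auto simp: degree_set_def)
qed

lemma degree_quadratic:
  assumes "d = \<alpha>1 \<or> d = \<alpha>2"
  defines "t \<equiv> real n * (real q - 1) - real q * real d"
  shows "t\<^sup>2 - (real q - 4) * t + 2 - real n * (real q - 1) = 0"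
proof -
  obtain u v where uv: "u \<in> C" "v \<in> C" "u \<noteq> v" "d = hamming_dist u v"
    using assms(1) by (rule degree_attained)
  let ?z = "\<lambda>j. chi_sum q (nsets {..<n} j) u v"
  have "?z 1 = t"
    unfolding chi_sum_nsets_1_eq_card[OF finite_lessThan]
    by (simp add: t_def uv(4) hamming_dist_def length_codeword[OF uv(1)])
  then have "t\<^sup>2 = 2 * ?z 2 + (real q - 2) * t + real n * (real q - 1)"
    using chi_sum_nsets_1_squared[of "{..<n}" q u v] by simp
  moreover have "1 + t + ?z 2 = 0"
  proof -
    have "1 + t + ?z 2 = (\<Sum>j\<le>2. ?z j)"
      using \<open>?z 1 = t\<close> by (simp add: numeral_2_eq_2 chi_sum_nsets_0 del: nsets_zero)
    also have "\<dots> = 0"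
      using chi_sum_design[OF uv(1,2)] uv(3) by (simp add: chi_sum_small_supports)
    finally show ?thesis .
  qed
  ultimately show ?thesis
    by algebra
qed

lemma degree_ge_2: "\<alpha>1 \<ge> 2"
proof -
  obtain u v where uv: "u \<in> C" "v \<in> C" "u \<noteq> v" "\<alpha>1 = hamming_dist u v"
    using degree_attained[of \<alpha>1] by metis
  then have "\<alpha>1 \<noteq> 0"
    using hamming_dist_eq_0_iff[of u v] by (simp add: length_codeword)
  moreover have "\<alpha>1 \<noteq> 1"
  proof
    assume "\<alpha>1 = 1"
    then have "(real n - 1) * (real n - 2) * (real q - 1)\<^sup>2 = 0"
      using degree_quadratic[of \<alpha>1] by (simp add: power2_eq_square algebra_simps)
    then show False
      using n_ge_4 q_ge_2 by auto
  qed
  ultimately show ?thesis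
    by simp
qed

text \<open>
  Two solutions of the quadratic equation which differ by \<open>q\<close> have sum \<open>q - 4\<close>, so the smaller one
  is \<open>-2\<close>, which is not a root.
\<close>

lemma degree_gap: "\<alpha>1 + 2 \<le> \<alpha>2"
proof -
  have "\<alpha>2 \<noteq> \<alpha>1 + 1"
  proof
    assume gap: "\<alpha>2 = \<alpha>1 + 1"
    define t where "t = real n * (real q - 1) - real q * real \<alpha>2"
    have root: "t\<^sup>2 - (real q - 4) * t + 2 - real n * (real q - 1) = 0"
      using degree_quadratic[of \<alpha>2] by (simp add: t_def)
    have "real n * (real q - 1) - real q * real \<alpha>1 = t + real q"
      by (simp add: t_def gap algebra_simps)
    then have "(t + real q)\<^sup>2 - (real q - 4) * (t + real q) + 2 - real n * (real q - 1) = 0"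
      using degree_quadratic[of \<alpha>1] by simp
    then have "real q * (2 * t + 4) = 0"
      using root by algebra
    then have "t = - 2"
      using q_pos by simp
    then have "(real n - 2) * (real q - 1) = 0"
      using root by (simp add: algebra_simps)
    then show False
      using n_ge_4 q_ge_2 by simp
  qed
  then show ?thesis
    using degrees_less by simp
qed

abbreviation X :: "nat list set" where
  "X \<equiv> tilde_code q C"

abbreviation R :: "nat \<Rightarrow> (nat list \<times> nat list) set" where
  "R \<equiv> tilde_rel q C \<alpha>1 \<alpha>2"

abbreviation distances :: "nat list" where
  "distances \<equiv> [0, \<alpha>1 - 1, \<alpha>1, \<alpha>2 - 1, \<alpha>2]"

lemma distinct_distances: "distinct distances"
  using degree_ge_2 degree_gap by auto

lemma inj_on_tl: "inj_on tl C"
proof (rule inj_onI, rule ccontr)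
  fix u v
  assume uv: "u \<in> C" "v \<in> C" "tl u = tl v" "u \<noteq> v"
  then have "hamming_dist u v \<le> 1"
    using hamming_dist_eq_0_iff[of "tl v" "tl v"]
    by (simp add: hamming_dist_eq_tl length_codeword codeword_nonempty)
  then show False
    using degree_cases[OF uv(1,2,4)] degree_ge_2 degrees_less by linarith
qed

lemma punctured_eq: "X = tl ` C"
  using subset_words n_pos by (rule tilde_code_eq_image_tl)

definition lift :: "nat list \<Rightarrow> nat list" where
  "lift = inv_into C tl"

lemma bij_betw_lift: "bij_betw lift X C"
  unfolding lift_def punctured_eq using inj_on_tl by (simp add: bij_betw_imageI bij_betw_inv_into)

lemma lift_in: "x \<in> X \<Longrightarrow> lift x \<in> C"
  using bij_betw_lift by (rule bij_betwE[rule_format])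

lemma lift_eq_iff: "x \<in> X \<Longrightarrow> y \<in> X \<Longrightarrow> lift x = lift y \<longleftrightarrow> x = y"
  using bij_betw_lift by (metis bij_betw_def inj_on_eq_iff)

lemma tl_lift: "x \<in> X \<Longrightarrow> tl (lift x) = x"
  unfolding lift_def punctured_eq by (rule f_inv_into_f)

lemma length_lift: "x \<in> X \<Longrightarrow> length (lift x) = n"
  by (simp add: lift_in length_codeword)

lemma length_punctured: "x \<in> X \<Longrightarrow> length x = n - 1"
  using length_lift[of x] tl_lift[of x] by (metis length_tl)

lemma card_punctured: "card X = card C"
  using bij_betw_lift by (rule bij_betw_same_card)

lemma finite_punctured: "finite X"
  using card_pos card_punctured card_ge_0_finite by metis

lemma hamming_dist_lift:
  assumes "x \<in> X" and "y \<in> X"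
  shows "hamming_dist (lift x) (lift y) = of_bool (lift x ! 0 \<noteq> lift y ! 0) + hamming_dist x y"
  using assms by (simp add: hamming_dist_eq_tl length_lift tl_lift lift_in codeword_nonempty)

lemma
  assumes "x \<in> X" and "y \<in> X"
  shows hamming_dist_in_distances: "hamming_dist x y \<in> set distances"
    and same_letter_iff: "lift x ! 0 = lift y ! 0 \<longleftrightarrow> hamming_dist x y \<in> {0, \<alpha>1, \<alpha>2}"
proof -
  let ?d = "hamming_dist (lift x) (lift y)"
  consider (equal) "x = y" | (near) "?d = \<alpha>1" | (far) "?d = \<alpha>2"
    using degree_cases[of "lift x" "lift y"] assms by (auto simp: lift_in lift_eq_iff)
  then have "hamming_dist x y \<in> set distances \<and>
    (lift x ! 0 = lift y ! 0 \<longleftrightarrow> hamming_dist x y \<in> {0, \<alpha>1, \<alpha>2})"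
  proof cases
    case equal
    then show ?thesis
      using hamming_dist_eq_0_iff[of x x] by simp
  qed (use hamming_dist_lift[OF assms] degree_ge_2 degree_gap in
      \<open>auto simp: of_bool_def split: if_splits\<close>)
  then show "hamming_dist x y \<in> set distances"
    and "lift x ! 0 = lift y ! 0 \<longleftrightarrow> hamming_dist x y \<in> {0, \<alpha>1, \<alpha>2}"
    by blast+
qed

lemma rel_iff: "(x, y) \<in> R k \<longleftrightarrow> x \<in> X \<and> y \<in> X \<and> hamming_dist x y = distances ! k"
  by (auto simp: tilde_rel_def)

lemma rel_partition_punctured:
  assumes "x \<in> X" and "y \<in> X"
  shows "\<exists>!k. k \<le> 4 \<and> (x, y) \<in> R k"
proof -
  have "\<exists>!k. k < length distances \<and> distances ! k = hamming_dist x y"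
    using distinct_distances hamming_dist_in_distances[OF assms] by (rule distinct_Ex1)
  moreover have "k \<le> 4 \<and> (x, y) \<in> R k
      \<longleftrightarrow> k < length distances \<and> distances ! k = hamming_dist x y" for k
    using assms by (auto simp: rel_iff)
  ultimately show ?thesis
    by simp
qed

definition zonal :: "nat \<Rightarrow> nat list mtx" where
  "zonal j x y = chi_sum q (supports n j) (lift x) (lift y)"

lemma zonal_0: "zonal 0 x y = 1"
  unfolding zonal_def supports_def by (simp add: chi_sum_nsets_0 del: nsets_zero)

lemma zonal_1:
  assumes "x \<in> X" and "y \<in> X"
  shows "zonal 1 x y = (real n - 1) * (real q - 1) - real q * real (hamming_dist x y)"
proof -
  have "zonal 1 x y = (real n - 1) * (real q - 1)
      - real q * real (card {k \<in> {1..<n}. lift x ! k \<noteq> lift y ! k})"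
    using chi_sum_nsets_1_eq_card[of "{1..<n}" q "lift x" "lift y"] n_pos
    by (simp add: zonal_def supports_def of_nat_diff)
  also have "card {k \<in> {1..<n}. lift x ! k \<noteq> lift y ! k} = hamming_dist x y"
    using assms hamming_dist_tl[of "lift x" "lift y"] by (simp add: length_lift tl_lift)
  finally show ?thesis .
qed

lemma zonal_1_mult_1:
  "zonal 1 x y * zonal 1 x y
    = (real n - 1) * (real q - 1) * zonal 0 x y + (real q - 2) * zonal 1 x y + 2 * zonal 2 x y"
  using chi_sum_nsets_1_squared[of "{1..<n}" q "lift x" "lift y"] n_pos
  by (simp add: zonal_0 zonal_def[of 1] zonal_def[of 2] supports_def of_nat_diff
      power2_eq_square del: One_nat_def)

lemma zonal_3: "zonal 3 x y = zonal 4 x y * zonal 1 x y"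
  unfolding zonal_def by (rule chi_sum_supports_3)

lemma zonal_4: "zonal 4 x y = centred_delta q (lift x ! 0) (lift y ! 0)"
  unfolding zonal_def by (rule chi_sum_supports_4)

lemma sum_zonal:
  assumes "x \<in> X" and "y \<in> X"
  shows "zonal 0 x y + zonal 1 x y + zonal 2 x y + zonal 3 x y + zonal 4 x y
    = real (card C) * of_bool (x = y)"
proof -
  have "(\<Sum>j\<le>4. zonal j x y) = chi_sum q (small_supports n 2) (lift x) (lift y)"
    unfolding zonal_def UN_supports[OF n_pos, symmetric]
    using finite_supports supports_disjoint by (intro chi_sum_UN_disjoint[symmetric]) auto
  then show ?thesis
    using assms by (simp add: chi_sum_design lift_in lift_eq_iff sum_atMost_4)
qed

lemma zonal_cong:
  assumes "x \<in> X" "y \<in> X" "x' \<in> X" "y' \<in> X" and "hamming_dist x y = hamming_dist x' y'" and "j \<le> 4"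
  shows "zonal j x y = zonal j x' y'"
proof -
  have zonal_1_eq: "zonal 1 x y = zonal 1 x' y'"
    using assms by (simp only: zonal_1)
  have zonal_4_eq: "zonal 4 x y = zonal 4 x' y'"
    using same_letter_iff[OF assms(1,2)] same_letter_iff[OF assms(3,4)] assms(5)
    by (simp add: zonal_4 centred_delta_def)
  from assms(6) show ?thesis
  proof (cases rule: le_4_cases)
    case two
    then show ?thesis
      using zonal_1_mult_1[of x y] zonal_1_mult_1[of x' y']
      by (simp add: zonal_0 zonal_1_eq del: One_nat_def)
  qed (simp_all only: zonal_0 zonal_1_eq zonal_3 zonal_4_eq)
qed

lemma zonal_convolution:
  assumes "i \<le> 4" and "j \<le> 4" and "x \<in> X" and "y \<in> X"
  shows "(\<Sum>z\<in>X. zonal i x z * zonal j z y) = real (card C) * of_bool (i = j) * zonal i x y"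
proof -
  have "(\<Sum>z\<in>X. zonal i x z * zonal j z y)
      = (\<Sum>z\<in>C. chi_sum q (supports n i) (lift x) z * chi_sum q (supports n j) z (lift y))"
    unfolding zonal_def using bij_betw_lift by (rule sum.reindex_bij_betw)
  also have "\<dots> = real (card C) * chi_sum q (supports n i \<inter> supports n j) (lift x) (lift y)"
  proof (rule chi_sum_convolution[OF design q_pos])
    show "supports n i \<subseteq> small_supports n 2" "supports n j \<subseteq> small_supports n 2"
      by (rule supports_subset[OF n_pos])+
    show "lift x \<in> words n q" "lift y \<in> words n q"
      using assms lift_in subset_words by blast+
  qed
  also have "\<dots> = real (card C) * of_bool (i = j) * zonal i x y"
    using supports_disjoint[OF assms(1,2)] by (cases "i = j") (simp_all add: zonal_def chi_sum_def)
  finally show ?thesis .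
qed

lemma zonal_same_pos: "zonal j x x > 0"
proof -
  have "(\<Sum>T\<in>supports n j. (real q - 1) ^ card T) > 0"
    using q_ge_2 finite_supports supports_nonempty[OF n_ge_4] by (intro sum_pos) auto
  then show ?thesis
    by (simp add: zonal_def chi_sum_same)
qed

definition E :: "nat \<Rightarrow> nat list mtx" where
  "E j x y = (if x \<in> X \<and> y \<in> X then zonal j x y / real (card C) else 0)"

sublocale orthogonal_idempotents X 4 E
proof
  fix i j :: nat
  assume ij: "i \<le> 4" "j \<le> 4"
  show "mtx_mult X (E i) (E j) = (if i = j then E i else mtx_zero)"
  proof (intro ext)
    fix x y
    show "mtx_mult X (E i) (E j) x y = (if i = j then E i else mtx_zero) x y"
    proof (cases "x \<in> X \<and> y \<in> X")
      case True
      then have "mtx_mult X (E i) (E j) x y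
          = (\<Sum>z\<in>X. zonal i x z * zonal j z y) / (real (card C))\<^sup>2"
        by (simp add: mtx_mult_def E_def power2_eq_square sum_divide_distrib)
      then show ?thesis
        using True card_pos
        by (simp add: zonal_convolution[OF ij] E_def mtx_zero_def power2_eq_square)
    qed (auto simp: mtx_mult_def E_def mtx_zero_def)
  qed
next
  fix j :: nat
  obtain x where "x \<in> X"
    using card_pos card_punctured by fastforce
  then have "E j x x \<noteq> 0"
    using zonal_same_pos[of j x] card_pos by (simp add: E_def)
  then show "E j \<noteq> mtx_zero"
    by (auto simp: mtx_zero_def)
qed

sublocale idempotent_scheme X 4 E R
proof
  show "finite X"
    by (rule finite_punctured)
  show "R i \<subseteq> X \<times> X" for i
    by (auto simp: rel_iff)
  show "R 0 = Id_on X"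
  proof (rule set_eqI)
    show "u \<in> R 0 \<longleftrightarrow> u \<in> Id_on X" for u
      by (cases u) (auto simp: rel_iff hamming_dist_eq_0_iff length_punctured)
  qed
  show "\<exists>!i. i \<le> 4 \<and> (x, y) \<in> R i" if "x \<in> X" "y \<in> X" for x y
    using that by (rule rel_partition_punctured)
  show "sym (R i)" for i
    by (auto simp: sym_def rel_iff hamming_dist_commute length_punctured)
  show "E j x y = 0" if "(x, y) \<notin> X \<times> X" for j x y
    using that by (auto simp: E_def)
  show "E j x y = E j x' y'" if "j \<le> 4" "(x, y) \<in> R i" "(x', y') \<in> R i" for i j x y x' y'
    using that zonal_cong[of x y x' y' j] by (simp add: rel_iff E_def)
qed

lemma zonal_4_mult_2:
  assumes "x \<in> X" and "y \<in> X"
  shows "zonal 4 x y * zonal 2 x y = (real q - 1) * zonal 2 x y"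
proof (cases "lift x ! 0 = lift y ! 0")
  case True
  then show ?thesis
    by (simp add: zonal_4 centred_delta_same)
next
  case False
  then have "zonal 4 x y = - 1" "x \<noteq> y"
    by (auto simp: zonal_4 centred_delta_def)
  then have "zonal 2 x y = 0"
    using sum_zonal[OF assms] by (simp add: zonal_0 zonal_3)
  then show ?thesis
    by simp
qed

lemma zonal_1_mult_3:
  assumes "x \<in> X" and "y \<in> X"
  shows "zonal 1 x y * zonal 3 x y
    = 2 * (real q - 1) * zonal 2 x y + (real q - 2) * zonal 3 x y
      + (real n - 1) * (real q - 1) * zonal 4 x y"
  using zonal_1_mult_1[of x y] zonal_4_mult_2[OF assms] unfolding zonal_0 zonal_3 by algebra

lemma zonal_1_mult_sum:
  assumes "x \<in> X" and "y \<in> X"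
  defines "s \<equiv> zonal 0 x y + zonal 1 x y + zonal 2 x y + zonal 3 x y + zonal 4 x y"
  shows "zonal 1 x y * s = (real n - 1) * (real q - 1) * s"
proof (cases "x = y")
  case True
  then have "zonal 1 x y = (real n - 1) * (real q - 1)"
    using zonal_1[OF assms(1,2)] hamming_dist_eq_0_iff[of x y] by simp
  then show ?thesis
    by simp
next
  case False
  then have "s = 0"
    using sum_zonal[OF assms(1,2)] by (simp add: s_def)
  then show ?thesis
    by simp
qed

lemma zonal_1_mult_2:
  assumes "x \<in> X" and "y \<in> X"
  shows "zonal 1 x y * zonal 2 x y = (real n - 2) * (real q - 1) * zonal 1 x y
    + ((real n - 1) * (real q - 1) - 2 * real q) * zonal 2 x y
    + (real n - 2) * (real q - 1) * zonal 3 x y"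
  using zonal_1_mult_sum[OF assms] zonal_1_mult_1[of x y] zonal_1_mult_3[OF assms] zonal_3[of x y]
  unfolding zonal_0 by algebra

definition krein_table :: "nat \<Rightarrow> nat \<Rightarrow> real" where
  "krein_table j k = (let r = real q - 1; m = (real n - 1) * r; b = (real n - 2) * r in
    if k \<le> 4 then
      [[0, 1, 0, 0, 0],
       [m, r - 1, 2, 0, 0],
       [0, b, m - 2 * real q, b, 0],
       [0, 0, 2 * r, r - 1, m],
       [0, 0, 0, 1, 0]] ! j ! k
    else 0)"

lemma zonal_1_mult:
  assumes "j \<le> 4" and "x \<in> X" and "y \<in> X"
  shows "zonal 1 x y * zonal j x y = (\<Sum>k\<le>4. krein_table j k * zonal k x y)"
  using assms(1)
proof (cases rule: le_4_cases)
  case zero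
  then show ?thesis
    by (simp add: sum_atMost_4 krein_table_def zonal_0)
next
  case one
  then show ?thesis
    by (simp add: sum_atMost_4 krein_table_def Let_def zonal_1_mult_1 algebra_simps
        del: One_nat_def)
next
  case two
  then show ?thesis
    by (simp add: sum_atMost_4 krein_table_def Let_def zonal_1_mult_2[OF assms(2,3)]
        del: One_nat_def)
next
  case three
  then show ?thesis
    by (simp add: sum_atMost_4 krein_table_def Let_def zonal_1_mult_3[OF assms(2,3)]
        del: One_nat_def)
next
  case four
  then show ?thesis
    by (simp add: sum_atMost_4 krein_table_def Let_def zonal_3)
qed

lemma krein_1:
  assumes "j \<le> 4"
  shows "krein X 4 E 1 j = krein_table j"
proof (rule krein_eqI)
  show "card X \<noteq> 0"
    using card_punctured card_pos by simp
  show "krein_table j k = 0" if "k > 4" for k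
    using that by (simp add: krein_table_def)
  fix x y
  show "E 1 x y * E j x y = 1 / real (card X) * (\<Sum>k\<le>4. krein_table j k * E k x y)"
  proof (cases "x \<in> X \<and> y \<in> X")
    case True
    then have "E 1 x y * E j x y = zonal 1 x y * zonal j x y / (real (card C))\<^sup>2"
      by (simp add: E_def power2_eq_square)
    also have "\<dots> = 1 / real (card X) * (\<Sum>k\<le>4. krein_table j k * E k x y)"
      using True assms
      by (simp add: zonal_1_mult E_def card_punctured power2_eq_square sum_divide_distrib
          del: One_nat_def)
    finally show ?thesis .
  qed (auto simp: E_def)
qed

lemma E_0: "E 0 = (\<lambda>x y. mtx_all_ones X x y / real (card X))"
  by (auto simp: E_def mtx_all_ones_def card_punctured zonal_0 fun_eq_iff)

lemma Q_polynomial: "Q_polynomial X 4 R E"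
  unfolding Q_polynomial_def
proof (intro conjI allI impI)
  show "association_scheme X 4 R"
    by (rule association_scheme)
  show "idempotent_ordering X 4 R E"
    using E_0 by (rule idempotent_orderingI)
  have pos: "real n > 2" "real q > 1"
    using n_ge_4 q_ge_2 by auto
  fix j k :: nat
  assume jk: "j \<le> 4" "k \<le> 4"
  from jk(1) show "krein X 4 E 1 j k = 0" if "k + 1 < j \<or> j + 1 < k"
    by (cases rule: le_4_cases; use jk(2) in \<open>cases rule: le_4_cases\<close>)
      (use that in \<open>simp_all add: krein_1 krein_table_def Let_def del: One_nat_def\<close>)
  from jk(1) show "krein X 4 E 1 j k \<noteq> 0" if "j = k + 1 \<or> k = j + 1"
    by (cases rule: le_4_cases; use jk(2) in \<open>cases rule: le_4_cases\<close>)
      (use that pos in \<open>simp_all add: krein_1 krein_table_def Let_def del: One_nat_def\<close>)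
qed simp

lemma krein_array:
  "krein_array X 4 E =
    ([(real n - 1) * (real q - 1), (real n - 2) * (real q - 1), 2 * (real q - 1), 1],
     [1, 2, (real n - 2) * (real q - 1), (real n - 1) * (real q - 1)])"
proof -
  have "[0..<4] = [0, 1, 2, 3]" "[1..<4 + 1] = [1, 2, 3, 4 :: nat]"
    by (simp_all add: upt_rec)
  then show ?thesis
    by (simp add: krein_array_def krein_b_def krein_c_def krein_1 krein_table_def Let_def
        del: One_nat_def)
qed

lemma Q_antipodal: "Q_antipodal X 4 R E"
  unfolding Q_antipodal_def
proof (intro conjI allI impI)
  show "Q_polynomial X 4 R E"
    by (rule Q_polynomial)
  fix i :: nat
  assume "i < 4" "i \<noteq> 4 div 2"
  then have "i = 0 \<or> i = 1 \<or> i = 3"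
    by auto
  then show "krein_b X 4 E i = krein_c X 4 E (4 - i)"
    by (auto simp: krein_b_def krein_c_def krein_1 krein_table_def Let_def simp del: One_nat_def)
qed

end

theorem theorem3p2:
  fixes q n \<alpha>1 \<alpha>2 :: nat and C :: "nat list set"
  assumes "q \<ge> 2" and "n \<ge> 2"
    and "tight_4_design n q C"
    and "degree_set C = {\<alpha>1, \<alpha>2}" and "\<alpha>1 < \<alpha>2"
  shows "association_scheme (tilde_code q C) 4 (tilde_rel q C \<alpha>1 \<alpha>2) \<and>
    (\<exists>E. Q_polynomial (tilde_code q C) 4 (tilde_rel q C \<alpha>1 \<alpha>2) E \<and>
         Q_antipodal (tilde_code q C) 4 (tilde_rel q C \<alpha>1 \<alpha>2) E \<and>
         krein_array (tilde_code q C) 4 E =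
           ([(real n - 1) * (real q - 1), (real n - 2) * (real q - 1), 2 * (real q - 1), 1],
            [1, 2, (real n - 2) * (real q - 1), (real n - 1) * (real q - 1)]))"
proof -
  interpret tight_design n q \<alpha>1 \<alpha>2 C
    using assms by unfold_locales
  show ?thesis
    using association_scheme Q_polynomial Q_antipodal krein_array by blast
qed

end
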